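(* Let $N\in\mathbb{N}$, $u\in C^\infty(\mathbb{S}^N)$ and $v:=\iota(u)$. Then $$\iota(\mathscr{P}^{\log}_g u)(x)=\phi(x)^{\frac N2}\,\mathscr{P}^{\log}_g u(\sigma^{-1}(x))=L_\Delta v(x)-2v(x)\ln\phi(x)\qquad\text{for all }x\in\mathbb{R}^N.$$
   Context: $\mathbb{S}^N\subset\mathbb{R}^{N+1}$ is the unit sphere with round metric $g$ and volume element $dV_g$; $|z-\zeta|$ is the Euclidean distance in $\mathbb{R}^{N+1}$. Let $c_N=\pi^{-N/2}\Gamma(\tfrac N2)$, $A_N=2\psi(\tfrac N2)$, $\psi=\Gamma'/\Gamma$. The conformal logarithmic Laplacian is $$\mathscr{P}^{\log}_g u(z)=c_N\int_{\mathbb{S}^N}\frac{u(z)-u(\zeta)}{|z-\zeta|^N}\,dV_g(\zeta)+A_Nu(z).$$ The stereographic projection from the south pole $-e_{N+1}$ is $\sigma:\mathbb{S}^N\setminus\{-e_{N+1}\}\to\mathbb{R}^N$, $\sigma(z',z_{N+1})=\frac{z'}{1+z_{N+1}}$, with inverse $\sigma^{-1}(x)=\left(\frac{2x}{1+|x|^2},\frac{1-|x|^2}{1+|x|^2}\right)$. Set $\phi(x)=\frac{2}{1+|x|^2}$ and, for $u:\mathbb{S}^N\setminus\{-e_{N+1}\}\to\mathbb{R}$, $\iota(u)(x):=\phi(x)^{N/2}u(\sigma^{-1}(x))$, $x\in\mathbb{R}^N$. The logarithmic Laplacian in $\mathbb{R}^N$ is $$L_\Delta v(x)=c_N\int_{B_1(x)}\frac{v(x)-v(y)}{|x-y|^N}\,dy-c_N\int_{\mathbb{R}^N\setminus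 B_1(x)}\frac{v(y)}{|x-y|^N}\,dy+\rho_Nv(x),$$ where $\rho_N=2\ln2+\psi(\tfrac N2)-\gamma$, $\gamma=-\Gamma'(1)$, and $B_1(x)$ is the open unit ball centered at $x$. *)

theory Defs
  imports "HOL-Analysis.Analysis"
begin

(* C^k and C-infinity maps, for open S. *)

fun Ck_on :: "nat \<Rightarrow> 'a::real_normed_vector set \<Rightarrow> ('a \<Rightarrow> 'b::real_normed_vector) \<Rightarrow> bool" where
  "Ck_on 0 S f \<longleftrightarrow> continuous_on S f"
| "Ck_on (Suc k) S f \<longleftrightarrow> (\<forall>x\<in>S. f differentiable (at x)) \<and>
     (\<forall>v. Ck_on k S (\<lambda>x. frechet_derivative f (at x) v))"

definition Cinf_on :: "'a::real_normed_vector set \<Rightarrow> ('a \<Rightarrow> 'b::real_normed_vector) \<Rightarrow> bool" where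
  "Cinf_on S f \<longleftrightarrow> (\<forall>k. Ck_on k S f)"

(* With N = CARD('n), the space R^(N+1) is the Euclidean product (real^'n) * real, so that a point
   is a pair (z', z_(N+1)) and S^N is the unit sphere of this type. *)

type_synonym 'n amb = "(real ^ 'n) \<times> real"

(* Smooth local parametrizations of S^N, i.e. inverses of the charts of its smooth structure.
   The image is automatically open in S^N (equal dimensions). *)

definition sphere_param :: "(real ^ 'n) set \<Rightarrow> (real ^ 'n \<Rightarrow> 'n::finite amb) \<Rightarrow> bool" where
  "sphere_param U f \<longleftrightarrow> open U \<and> Cinf_on U f \<and> inj_on f U \<and> f ` U \<subseteq> sphere 0 1 \<and>
     (\<forall>x\<in>U. inj (frechet_derivative f (at x)))"

(* Values of u outside the sphere play no role. *)

definition smooth_on_sphere :: "('n::finite amb \<Rightarrow> real) \<Rightarrow> bool" where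
  "smooth_on_sphere u \<longleftrightarrow> (\<forall>U f. sphere_param U f \<longrightarrow> Cinf_on U (u \<circ> f))"

(* The matrix g_ij of the round metric (induced from R^(N+1)) in the parametrization f. *)

definition metric_matrix :: "(real ^ 'n \<Rightarrow> 'n::finite amb) \<Rightarrow> real ^ 'n \<Rightarrow> real ^ 'n ^ 'n" where
  "metric_matrix f x = (\<chi> i j. frechet_derivative f (at x) (axis i 1) \<bullet>
                               frechet_derivative f (at x) (axis j 1))"

(* dV_g = sqrt (det g_ij) dx in every local parametrization. *)

definition is_round_volume :: "'n::finite amb measure \<Rightarrow> bool" where
  "is_round_volume M \<longleftrightarrow> sets M = sets (restrict_space borel (sphere 0 1)) \<and>
     (\<forall>U f A. sphere_param U f \<longrightarrow> A \<in> sets M \<longrightarrow> A \<subseteq> f ` U \<longrightarrow>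
        emeasure M A = (\<integral>\<^sup>+x\<in>U. ennreal (sqrt (det (metric_matrix f x))) * indicator A (f x) \<partial>lborel))"

definition round_volume :: "'n::finite amb measure" where
  "round_volume = (THE M. is_round_volume M)"

definition c_const :: "nat \<Rightarrow> real" where
  "c_const N = pi powr (- real N / 2) * Gamma (real N / 2)"

definition A_const :: "nat \<Rightarrow> real" where
  "A_const N = 2 * Digamma (real N / 2)"

definition rho_const :: "nat \<Rightarrow> real" where
  "rho_const N = 2 * ln 2 + Digamma (real N / 2) - euler_mascheroni"

(* The library's Digamma and euler_mascheroni are Gamma' / Gamma and - Gamma' 1. *)

lemma Digamma_eq_deriv_Gamma: "Digamma x = deriv Gamma x / Gamma x" if "x > 0" for x :: real
proof -
  have nonpos: "x \<notin> \<int>\<^sub>\<le>\<^sub>0" using that by auto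
  then have "deriv Gamma x = Gamma x * Digamma x"
    by (intro DERIV_imp_deriv has_field_derivative_Gamma)
  with nonpos show ?thesis by (simp add: Gamma_eq_zero_iff)
qed

lemma euler_mascheroni_eq_deriv_Gamma: "euler_mascheroni = - deriv Gamma (1::real)"
  using Digamma_eq_deriv_Gamma[of 1] by simp

(* The conformal logarithmic Laplacian on S^N. *)

definition Plog :: "('n::finite amb \<Rightarrow> real) \<Rightarrow> 'n amb \<Rightarrow> real" where
  "Plog u z = c_const CARD('n) *
       (\<integral>\<zeta>. (u z - u \<zeta>) / norm (z - \<zeta>) ^ CARD('n) \<partial>round_volume)
     + A_const CARD('n) * u z"

(* The logarithmic Laplacian on R^N. *)

definition log_Laplacian :: "(real ^ 'n::finite \<Rightarrow> real) \<Rightarrow> real ^ 'n \<Rightarrow> real" where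
  "log_Laplacian v x =
       c_const CARD('n) * (LINT y:ball x 1|lborel. (v x - v y) / norm (x - y) ^ CARD('n))
     - c_const CARD('n) * (LINT y:- ball x 1|lborel. v y / norm (x - y) ^ CARD('n))
     + rho_const CARD('n) * v x"

(* Stereographic projection from the south pole (0, -1), and its inverse. *)

definition stereo :: "'n::finite amb \<Rightarrow> real ^ 'n" where
  "stereo z = fst z /\<^sub>R (1 + snd z)"

definition stereo_inv :: "real ^ 'n::finite \<Rightarrow> 'n amb" where
  "stereo_inv x = ((2 / (1 + (norm x)\<^sup>2)) *\<^sub>R x, (1 - (norm x)\<^sup>2) / (1 + (norm x)\<^sup>2))"

definition phi :: "real ^ 'n::finite \<Rightarrow> real" where
  "phi x = 2 / (1 + (norm x)\<^sup>2)"

definition iota :: "('n::finite amb \<Rightarrow> real) \<Rightarrow> real ^ 'n \<Rightarrow> real" where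
  "iota u x = phi x powr (real CARD('n) / 2) * u (stereo_inv x)"

lemma stereo_stereo_inv: "stereo (stereo_inv x) = x"
proof -
  have pos: "1 + (norm x)\<^sup>2 > 0" by (simp add: add_pos_nonneg)
  then have "1 + snd (stereo_inv x) = 2 / (1 + (norm x)\<^sup>2)"
    by (simp add: stereo_inv_def field_simps)
  then have "stereo (stereo_inv x) = (2 / (1 + (norm x)\<^sup>2)) *\<^sub>R x /\<^sub>R (2 / (1 + (norm x)\<^sup>2))"
    by (simp only: stereo_def) (simp add: stereo_inv_def)
  moreover have "2 / (1 + (norm x)\<^sup>2) \<noteq> 0" using pos by simp
  ultimately show ?thesis by (metis scaleR_scaleR left_inverse scaleR_one)
qed

lemma stereo_inv_stereo:
  assumes "z \<in> sphere 0 1" "z \<noteq> (0, -1)"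
  shows "stereo_inv (stereo z) = z"
proof -
  obtain a b where z: "z = (a, b)" by (cases z)
  have ab: "(norm a)\<^sup>2 + b\<^sup>2 = 1"
    using assms(1) by (simp add: z norm_Pair real_sqrt_eq_1_iff)
  have b: "1 + b \<noteq> 0"
  proof
    assume "1 + b = 0"
    then have "b = -1" by simp
    with ab have "a = 0" by simp
    with \<open>b = -1\<close> assms(2) show False by (simp add: z)
  qed
  have "(norm (stereo z))\<^sup>2 = (1 - b\<^sup>2) / (1 + b)\<^sup>2"
    using ab by (simp add: stereo_def z power_mult_distrib power_inverse divide_inverse mult.commute)
  also have "\<dots> = (1 - b) / (1 + b)"
  proof -
    have "1 - b\<^sup>2 = (1 - b) * (1 + b)" by (simp add: algebra_simps power2_eq_square)
    with b show ?thesis by (simp add: power2_eq_square)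
  qed
  finally have n: "(norm (stereo z))\<^sup>2 = (1 - b) / (1 + b)" .
  have n1: "1 + (norm (stereo z))\<^sup>2 = 2 / (1 + b)" and n2: "1 - (norm (stereo z))\<^sup>2 = 2 * b / (1 + b)"
    unfolding n using b by (simp_all add: field_simps)
  have "2 / (2 / (1 + b)) * inverse (1 + b) = 1"
    using b by (simp only: divide_divide_eq_right nonzero_mult_div_cancel_left right_inverse)
      (simp add: b)
  then have "(2 / (2 / (1 + b))) *\<^sub>R stereo z = a"
    by (simp only: stereo_def z fst_conv snd_conv scaleR_scaleR scaleR_one)
  moreover have "2 * b / (1 + b) / (2 / (1 + b)) = b" using b by simp
  ultimately show ?thesis
    unfolding stereo_inv_def n1 n2 by (simp only: z)
qed

end

(* In stereographic coordinates the round volume is phi^N dy and the chordal distance is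
   sqrt (phi x * phi y) |x - y|, so with w = phi^(N/2) and U = u o stereo_inv the left-hand side is
   c_N times the integral of (U(x) w(y) - v(y)) / |x - y|^N, plus A_N v(x). Splitting at the unit
   sphere about x, this equals L v(x) - U(x) L w(x) + A_N v(x), where L is the logarithmic Laplacian,
   and everything reduces to u = 1, that is, to L w = (A_N + 2 ln phi) w.
   The inversion y = x + q / |q|^2 maps w(y) |x - y|^(-N) dy to
   w(x) (|q + a|^2 + b^2)^(-N/2) dq with b = phi(x) / 2 and swaps the unit ball about x with the
   exterior of the unit ball. Integrating over |q| < R, the shift by a costs o(1), and what is left is a
   radial integral whose logarithmic asymptotics gives the digamma function. *)

theory Submission
  imports Defs "HOL-Real_Asymp.Real_Asymp"
begin

text \<open>Convergence shapes the argument. The kernel \<open>|x - y|^(-N)\<close> is not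
  integrable at \<open>x\<close>, and its image under inversion is not integrable at infinity, so
  cancellations must be arranged before an integral is split. Near \<open>x\<close> the difference
  quotients of \<open>v\<close> and \<open>w\<close> converge because both are C^1; on the ball,
  \<open>U(x) w(y) - v(y)\<close> is \<open>(v(x) - v(y)) - U(x) (w(x) - w(y))\<close>, since
  \<open>v(x) = U(x) w(x)\<close>. Away from \<open>x\<close> convergence comes from boundedness of
  \<open>u\<close> and the decay of \<open>w\<close>. The constants fit as follows.
  \<open>c_N\<close> times the area of the unit sphere of R^N is 2. In units of that area the
  regularized radial integral equals \<open>- (psi + gamma) / 2 - ln b\<close>, with
  \<open>psi\<close> taken at \<open>N / 2\<close>, so \<open>- c_N\<close> times it is
  \<open>psi + gamma + 2 ln b\<close>. Adding \<open>rho_N\<close> removes \<open>gamma\<close>,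
  doubles \<open>psi\<close> and completes \<open>2 ln b\<close> to
  \<open>2 ln (2 b) = 2 ln phi\<close>. The round volume is a definite description constrained chart
  by chart, so nothing can be computed before existence and uniqueness are known. Stereographic
  coordinates miss one point; a second, reflected chart takes care of it.\<close>

section \<open>Change of variables\<close>

text \<open>The library's change of variables theorem requires a well-ordered index type. A finite index
  type carries no order, so the theorem is transported along a bijection with \<open>'n fin_index\<close>.\<close>

typedef (overloaded) 'n fin_index = "{..<CARD('n::finite)}"
  by (rule exI[of _ 0]) simp

instantiation fin_index :: (finite) wellorder
begin

definition less_eq_fin_index :: "'a fin_index \<Rightarrow> 'a fin_index \<Rightarrow> bool" where
  "less_eq_fin_index i j \<longleftrightarrow> Rep_fin_index i \<le> Rep_fin_index j"

definition less_fin_index :: "'a fin_index \<Rightarrow> 'a fin_index \<Rightarrow> bool" where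
  "less_fin_index i j \<longleftrightarrow> Rep_fin_index i < Rep_fin_index j"

instance
proof
  fix P :: "'a fin_index \<Rightarrow> bool" and a
  assume step: "\<And>x. (\<And>y. y < x \<Longrightarrow> P y) \<Longrightarrow> P x"
  show "P a"
    by (induction a rule: measure_induct_rule[of Rep_fin_index])
      (use step in \<open>auto simp: less_fin_index_def\<close>)
qed (auto simp: less_eq_fin_index_def less_fin_index_def Rep_fin_index_inject)

end

lemma fin_index_bij: "bij_betw Rep_fin_index (UNIV :: 'n::finite fin_index set) {..<CARD('n)}"
  by (metis bij_betw_def inj_onI Rep_fin_index_inject type_definition.Rep_range type_definition_fin_index)

instance fin_index :: (finite) finite
  by standard (metis bij_betw_finite fin_index_bij finite_lessThan)

lemma ex_bij_fin_index: "\<exists>e :: 'n::finite fin_index \<Rightarrow> 'n. bij e"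
proof -
  have "card (UNIV :: 'n fin_index set) = card (UNIV :: 'n set)"
    using bij_betw_same_card[OF fin_index_bij] by simp
  then show ?thesis
    by (intro finite_same_card_bij[where A = "UNIV :: 'n fin_index set" and B = "UNIV :: 'n set", simplified])
qed

section \<open>Permutations of coordinates, Lebesgue measure and determinants\<close>

definition reindex :: "('m \<Rightarrow> 'n) \<Rightarrow> real ^ 'n::finite \<Rightarrow> real ^ 'm::finite" where
  "reindex e x = (\<chi> i. x $ e i)"

lemma linear_reindex: "linear (reindex e)"
  by (rule linearI) (auto simp: reindex_def vec_eq_iff)

lemma reindex_inv:
  assumes "bij e"
  shows "reindex e (reindex (inv e) y) = y" "reindex (inv e) (reindex e x) = x"
  using assms by (auto simp: reindex_def vec_eq_iff bij_is_inj bij_is_surj surj_f_inv_f)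

lemma reindex_measurable [measurable]: "reindex e \<in> borel_measurable borel"
  by (intro borel_measurable_continuous_onI linear_continuous_on linear_linear[THEN iffD2]
      linear_conv_bounded_linear[THEN iffD1] linear_reindex)

lemma prod_Basis_cart:
  fixes z :: "real ^ 'k::finite"
  shows "(\<Prod>b\<in>Basis. z \<bullet> b) = (\<Prod>i\<in>UNIV. z $ i)"
proof -
  have eq: "(Basis :: (real ^ 'k) set) = range (\<lambda>i. axis i 1)"
    by (auto simp: Basis_vec_def)
  have "inj (\<lambda>i::'k. axis i (1::real))" by (auto simp: inj_on_def axis_eq_axis)
  then show ?thesis unfolding eq by (simp add: prod.reindex inner_axis o_def)
qed

text \<open>Lebesgue measure is determined by its values on boxes, and relabelling coordinates takes
  boxes to boxes with the same side lengths.\<close>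

lemma lborel_reindex:
  fixes e :: "'m::finite \<Rightarrow> 'n::finite"
  assumes "bij e"
  shows "distr lborel borel (reindex e) = (lborel :: (real ^ 'm) measure)"
proof (rule lborel_eqI[symmetric])
  fix l u :: "real ^ 'm"
  assume le: "\<And>b. b \<in> Basis \<Longrightarrow> l \<bullet> b \<le> u \<bullet> b"
  have le': "l $ i \<le> u $ i" for i
    using le[of "axis i 1"] by (simp add: axis_in_Basis_iff inner_axis)
  have pre: "reindex e -` box l u = box (reindex (inv e) l) (reindex (inv e) u)"
  proof (intro set_eqI iffI)
    fix x
    assume "x \<in> reindex e -` box l u"
    then have "l $ i < x $ e i \<and> x $ e i < u $ i" for i by (auto simp: mem_box_cart reindex_def)
    from this[of "inv e _"] show "x \<in> box (reindex (inv e) l) (reindex (inv e) u)"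
      using assms by (simp add: mem_box_cart reindex_def bij_is_surj surj_f_inv_f)
  next
    fix x
    assume "x \<in> box (reindex (inv e) l) (reindex (inv e) u)"
    then have "l $ inv e j < x $ j \<and> x $ j < u $ inv e j" for j by (auto simp: mem_box_cart reindex_def)
    from this[of "e _"] show "x \<in> reindex e -` box l u"
      using assms by (simp add: mem_box_cart reindex_def bij_is_inj)
  qed
  have "emeasure (distr lborel borel (reindex e)) (box l u)
      = emeasure lborel (box (reindex (inv e) l) (reindex (inv e) u))"
    by (simp add: emeasure_distr pre)
  also have "\<dots> = (\<Prod>b\<in>Basis. (reindex (inv e) u - reindex (inv e) l) \<bullet> b)"
    by (rule emeasure_lborel_box) (auto simp: Basis_vec_def inner_axis reindex_def le')
  also have "\<dots> = (\<Prod>j\<in>UNIV. (u - l) $ inv e j)"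
    by (simp only: prod_Basis_cart) (simp add: reindex_def)
  also have "\<dots> = (\<Prod>i\<in>UNIV. (u - l) $ i)"
    using prod.reindex_bij_betw[OF bij_imp_bij_inv[OF assms], of "\<lambda>i. (u - l) $ i"] by simp
  also have "\<dots> = (\<Prod>b\<in>Basis. (u - l) \<bullet> b)" by (simp only: prod_Basis_cart)
  finally show "emeasure (distr lborel borel (reindex e)) (box l u) = (\<Prod>b\<in>Basis. (u - l) \<bullet> b)" .
qed simp

lemma det_reindex:
  fixes e :: "'m::finite \<Rightarrow> 'n::finite" and A :: "real ^ 'n ^ 'n"
  assumes "bij e"
  shows "det (\<chi> i j. A $ e i $ e j) = det A"
proof -
  have inj: "inj e" and surj: "surj e" using assms by (auto simp: bij_def)
  \<comment> \<open>Conjugation of a permutation by \<open>e\<close>, the bijection that reindexes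
    the Leibniz sum. The vacuous test \<open>x \<in> UNIV\<close> matches the form in
    \<open>bij_betw_permutations\<close>.\<close>
  let ?h = "\<lambda>\<pi> x. if x \<in> UNIV then e (\<pi> (inv e x)) else x"
  have h: "?h \<pi> = map_permutation UNIV e \<pi>" for \<pi>
    by (auto simp: map_permutation_def fun_eq_iff restrict_id_def surj)
  have "det A = (\<Sum>p\<in>{p. p permutes UNIV}. of_int (sign (?h p)) * (\<Prod>i\<in>UNIV. A $ i $ ?h p i))"
    unfolding det_def
    by (rule sum.reindex_bij_betw[OF bij_betw_permutations[OF assms], symmetric])
  also have "\<dots> = (\<Sum>p\<in>{p. p permutes UNIV}. of_int (sign p) * (\<Prod>i\<in>UNIV. A $ e i $ e (p i)))"
  proof (rule sum.cong[OF refl])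
    fix p :: "'m \<Rightarrow> 'm" assume "p \<in> {p. p permutes UNIV}"
    then have "sign (?h p) = sign p"
      unfolding h by (intro sign_map_permutation) (auto simp: inj)
    moreover have "(\<Prod>i\<in>UNIV. A $ i $ ?h p i) = (\<Prod>i\<in>UNIV. A $ e i $ e (p i))"
      by (subst prod.reindex_bij_betw[OF assms, symmetric]) (simp add: inj)
    ultimately show "of_int (sign (?h p)) * (\<Prod>i\<in>UNIV. A $ i $ ?h p i)
        = of_int (sign p) * (\<Prod>i\<in>UNIV. A $ e i $ e (p i))" by simp
  qed
  finally show ?thesis by (simp add: det_def)
qed

text \<open>\<open>has_measure_differentiable_image\<close> is an equivalence for a real value
  \<open>m\<close>. If the right-hand side is finite, it applies directly; if it is infinite, a
  finite measure of the image would by the same equivalence make \<open>J\<close> integrable on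
  \<open>S\<close>, a contradiction. \<open>J\<close> is a Borel representative of the Jacobian,
  since \<open>g'\<close> is arbitrary off \<open>S\<close>.\<close>

lemma emeasure_differentiable_image_wellorder:
  fixes g :: "real ^ 'm::{finite,wellorder} \<Rightarrow> real ^ 'm::_"
  assumes S: "S \<in> sets borel" and gS: "g ` S \<in> sets borel"
    and der: "\<And>x. x \<in> S \<Longrightarrow> (g has_derivative g' x) (at x within S)"
    and inj: "inj_on g S"
    and J: "J \<in> borel_measurable borel" "\<And>x. x \<in> S \<Longrightarrow> J x = \<bar>det (matrix (g' x))\<bar>"
  shows "emeasure lborel (g ` S) = (\<integral>\<^sup>+x. ennreal (J x) * indicator S x \<partial>lborel)"
proof -
  have SL: "S \<in> sets lebesgue" using S by simp
  note main = has_measure_differentiable_image[OF SL der inj]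
  have cong: "((\<lambda>x. \<bar>det (matrix (g' x))\<bar>) has_integral m) S \<longleftrightarrow> (J has_integral m) S" for m
    by (rule has_integral_cong) (use J in auto)
  show ?thesis
  proof (cases "(\<integral>\<^sup>+x. ennreal (J x) * indicator S x \<partial>lborel)")
    case (real m)
    have "(\<integral>\<^sup>+x. ennreal (J x * indicator S x) \<partial>lborel)
        = (\<integral>\<^sup>+x. ennreal (J x) * indicator S x \<partial>lborel)"
      by (rule nn_integral_cong) (simp split: split_indicator)
    then have eq: "(\<integral>\<^sup>+x. ennreal (J x * indicator S x) \<partial>lborel) = ennreal m"
      using real by simp
    have "((\<lambda>x. J x * indicator S x) has_integral m) UNIV"
      by (intro nn_integral_has_integral)
        (use S J eq real in \<open>auto split: split_indicator\<close>)
    moreover have "(\<lambda>x. J x * indicator S x) = (\<lambda>x. if x \<in> S then J x else 0)"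
      by auto
    ultimately have "(J has_integral m) S"
      by (simp add: has_integral_restrict_UNIV)
    then have "g ` S \<in> lmeasurable \<and> measure lebesgue (g ` S) = m"
      using main[of m] by (simp add: cong)
    then have "emeasure lebesgue (g ` S) = ennreal m"
      using emeasure_eq_ennreal_measure[OF fmeasurableD2] by blast
    with gS real show ?thesis by simp
  next
    case top
    show ?thesis
    proof (cases "emeasure lborel (g ` S)")
      case (real m)
      then have "g ` S \<in> lmeasurable \<and> measure lebesgue (g ` S) = m"
        using gS by (intro conjI fmeasurableI) (simp_all add: measure_def)
      then have "(J has_integral m) S" using main[of m] by (simp add: cong)
      from nn_integral_has_integral_lebesgue'[OF _ this] J
      have "(\<integral>\<^sup>+x. ennreal (J x) * indicator S x \<partial>lborel) = ennreal m" by simp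
      with top show ?thesis by simp
    qed (use top in simp)
  qed
qed

text \<open>Conjugating \<open>g\<close> with the relabelling moves it to the well-ordered index
  type. Measures are preserved, and the Jacobian matrix only has its rows and columns permuted
  simultaneously, so its determinant is unchanged.\<close>

lemma emeasure_differentiable_image:
  fixes g :: "real ^ 'n::finite \<Rightarrow> real ^ 'n"
  assumes S: "S \<in> sets borel" and gS: "g ` S \<in> sets borel"
    and der: "\<And>x. x \<in> S \<Longrightarrow> (g has_derivative g' x) (at x within S)"
    and inj: "inj_on g S"
    and J: "J \<in> borel_measurable borel" "\<And>x. x \<in> S \<Longrightarrow> J x = \<bar>det (matrix (g' x))\<bar>"
  shows "emeasure lborel (g ` S) = (\<integral>\<^sup>+x. ennreal (J x) * indicator S x \<partial>lborel)"
proof -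
  obtain e :: "'n fin_index \<Rightarrow> 'n" where e: "bij e" using ex_bij_fin_index by blast
  let ?P = "reindex e" and ?Q = "reindex (inv e)"
  note inv = reindex_inv[OF e]
  have lb: "(lborel :: (real ^ 'n) measure) = distr lborel borel ?Q"
    by (rule lborel_reindex[symmetric]) (rule bij_imp_bij_inv[OF e])
  have PQ: "?Q -` A = ?P ` A" for A
    using inv by (auto simp: image_iff) metis
  have bl: "bounded_linear (reindex f :: real ^ 'a::finite \<Rightarrow> real ^ 'b::finite)" for f
    by (simp add: linear_conv_bounded_linear[symmetric] linear_reindex)
  have im: "(?P \<circ> g \<circ> ?Q) ` (?Q -` S) = ?Q -` (g ` S)"
    unfolding PQ by (simp add: image_comp inv o_def)
  have "emeasure lborel (g ` S) = emeasure lborel (?Q -` (g ` S))"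
    by (subst lb) (use gS in \<open>simp add: emeasure_distr\<close>)
  also have "\<dots> = emeasure lborel ((?P \<circ> g \<circ> ?Q) ` (?Q -` S))" by (simp only: im)
  also have "\<dots> = (\<integral>\<^sup>+y. ennreal (J (?Q y)) * indicator (?Q -` S) y \<partial>lborel)"
  proof (rule emeasure_differentiable_image_wellorder[where g' = "\<lambda>y. ?P \<circ> g' (?Q y) \<circ> ?Q"])
    show "?Q -` S \<in> sets borel"
      using measurable_sets[OF reindex_measurable S] by simp
    show "(?P \<circ> g \<circ> ?Q) ` (?Q -` S) \<in> sets borel"
      unfolding im using measurable_sets[OF reindex_measurable gS] by simp
    show "((?P \<circ> g \<circ> ?Q) has_derivative ?P \<circ> g' (?Q y) \<circ> ?Q) (at y within ?Q -` S)"
      if "y \<in> ?Q -` S" for y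
    proof -
      have "(g has_derivative g' (?Q y)) (at (?Q y) within ?Q ` (?Q -` S))"
        using der[of "?Q y"] that by (auto intro: has_derivative_subset)
      then show ?thesis
        unfolding o_assoc[symmetric]
        by (intro diff_chain_within bounded_linear_imp_has_derivative bl)
    qed
    show "inj_on (?P \<circ> g \<circ> ?Q) (?Q -` S)"
      using inj inv by (auto simp: inj_on_def) metis
    show "(\<lambda>y. J (?Q y)) \<in> borel_measurable borel" using J by measurable
    show "J (?Q y) = \<bar>det (matrix (?P \<circ> g' (?Q y) \<circ> ?Q))\<bar>" if "y \<in> ?Q -` S" for y
    proof -
      have ax: "?Q (axis j 1) = axis (e j) 1" for j
      proof -
        have "inv e k = j \<longleftrightarrow> k = e j" for k
          using bij_inv_eq_iff[OF e, of j k] by auto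
        then show ?thesis by (simp add: reindex_def vec_eq_iff axis_def)
      qed
      have "matrix (?P \<circ> g' (?Q y) \<circ> ?Q) = (\<chi> i j. matrix (g' (?Q y)) $ e i $ e j)"
        by (simp add: matrix_def vec_eq_iff ax) (simp add: reindex_def)
      with J that show ?thesis by (simp add: det_reindex[OF e])
    qed
  qed
  also have "\<dots> = (\<integral>\<^sup>+x. ennreal (J x) * indicator S x \<partial>lborel)"
    by (subst lb) (use S J in \<open>simp add: nn_integral_distr indicator_def\<close>)
  finally show ?thesis .
qed

lemma nn_integral_change_of_variables:
  fixes g :: "real ^ 'n::finite \<Rightarrow> real ^ 'n"
  assumes S: "S \<in> sets borel" and gS: "g ` S \<in> sets borel"
    and der: "\<And>x. x \<in> S \<Longrightarrow> (g has_derivative g' x) (at x within S)"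
    and inj: "inj_on g S"
    and J: "J \<in> borel_measurable borel" "\<And>x. x \<in> S \<Longrightarrow> J x = \<bar>det (matrix (g' x))\<bar>"
    and h [measurable]: "h \<in> borel_measurable borel"
  shows "(\<integral>\<^sup>+y. h y * indicator (g ` S) y \<partial>lborel)
       = (\<integral>\<^sup>+x. ennreal (J x) * h (g x) * indicator S x \<partial>lborel)"
proof -
  note [measurable] = S gS J(1)
  have "continuous_on S g"
    using der by (auto intro!: has_derivative_continuous simp: continuous_on_eq_continuous_within)
  then have gm: "g \<in> borel_measurable (restrict_space borel S)"
    by (rule borel_measurable_continuous_on_restrict)
  \<comment> \<open>\<open>g\<close> is controlled only on \<open>S\<close>; its extension by zero
    is Borel on the whole space, as a pushforward requires.\<close>
  define g0 where "g0 x = (if x \<in> S then g x else 0)" for x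
  have g0 [measurable]: "g0 \<in> borel_measurable borel"
    unfolding g0_def using gm S by (subst measurable_restrict_space_iff[symmetric]) auto
  have "density lborel (indicator (g ` S))
      = distr (density lborel (\<lambda>x. ennreal (J x) * indicator S x)) borel g0"
  proof (rule measure_eqI)
    fix A assume "A \<in> sets (density lborel (indicator (g ` S)))"
    then have A [measurable]: "A \<in> sets borel" by simp
    define T where "T = S \<inter> g0 -` A"
    have T: "T \<in> sets borel" unfolding T_def using measurable_sets[OF g0 A] S by simp
    have im: "g ` T = A \<inter> g ` S" by (auto simp: T_def g0_def)
    have "emeasure (density lborel (indicator (g ` S))) A
        = (\<integral>\<^sup>+y. indicator (A \<inter> g ` S) y \<partial>lborel)"
      by (subst emeasure_density, simp, simp, rule nn_integral_cong) (simp split: split_indicator)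
    also have "\<dots> = emeasure lborel (g ` T)"
      unfolding im by simp
    also have "\<dots> = (\<integral>\<^sup>+x. ennreal (J x) * indicator T x \<partial>lborel)"
    proof (rule emeasure_differentiable_image[OF T _ _ _ J(1)])
      show "g ` T \<in> sets borel" unfolding im using A gS by simp
      show "(g has_derivative g' x) (at x within T)" if "x \<in> T" for x
        using that by (auto simp: T_def intro: has_derivative_subset[OF der])
      show "inj_on g T" using inj by (rule inj_on_subset) (auto simp: T_def)
    qed (auto simp: T_def J(2))
    also have "\<dots> = emeasure (distr (density lborel (\<lambda>x. ennreal (J x) * indicator S x)) borel g0) A"
      using measurable_sets[OF g0 A]
      by (simp add: emeasure_distr emeasure_density T_def)
        (auto intro!: nn_integral_cong split: split_indicator)
    finally show "emeasure (density lborel (indicator (g ` S))) A =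
      emeasure (distr (density lborel (\<lambda>x. ennreal (J x) * indicator S x)) borel g0) A" .
  qed simp
  note eq = this
  have "(\<integral>\<^sup>+y. h y * indicator (g ` S) y \<partial>lborel)
      = (\<integral>\<^sup>+y. h y \<partial>density lborel (indicator (g ` S)))"
    by (simp add: nn_integral_density mult.commute)
  also have "\<dots> = (\<integral>\<^sup>+x. ennreal (J x) * indicator S x * h (g0 x) \<partial>lborel)"
    unfolding eq by (simp add: nn_integral_density nn_integral_distr)
  also have "\<dots> = (\<integral>\<^sup>+x. ennreal (J x) * h (g x) * indicator S x \<partial>lborel)"
    by (rule nn_integral_cong) (simp add: g0_def split: split_indicator)
  finally show ?thesis .
qed

section \<open>Stereographic coordinates\<close>

lemma Ck_on_Suc_UNIV_I:
  assumes "\<And>x. (f has_derivative D x) (at x)" and "\<And>v. Ck_on k UNIV (\<lambda>x. D x v)"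
  shows "Ck_on (Suc k) UNIV f"
proof -
  have "frechet_derivative f (at x) = D x" for x
    using frechet_derivative_at[OF assms(1)] by simp
  then show ?thesis using assms by (auto simp: differentiable_def)
qed

text \<open>Derivatives of products and inverses contain the undifferentiated factors, so those
  inductions need their hypotheses one order lower as well.\<close>

lemma Ck_on_Suc_imp_Ck_on: "Ck_on (Suc k) S f \<Longrightarrow> Ck_on k S f"
proof (induction k arbitrary: f)
  case 0
  then show ?case
    by (auto intro!: continuous_at_imp_continuous_on differentiable_imp_continuous_within)
qed simp

lemma Ck_on_Suc_UNIV_D:
  assumes "Ck_on (Suc k) UNIV f"
  shows "(f has_derivative frechet_derivative f (at x)) (at x)"
    and "Ck_on k UNIV (\<lambda>x. frechet_derivative f (at x) v)"
  using assms by (auto simp: frechet_derivative_works)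

lemma Ck_on_const: "Ck_on k UNIV (\<lambda>x. c)"
proof (induction k arbitrary: c)
  case (Suc k)
  then show ?case by (intro Ck_on_Suc_UNIV_I[where D = "\<lambda>_ _. 0"]) auto
qed simp

lemma Ck_on_bounded_linear: "bounded_linear f \<Longrightarrow> Ck_on k UNIV f"
proof (cases k)
  case (Suc l)
  assume f: "bounded_linear f"
  then show ?thesis unfolding Suc
    by (intro Ck_on_Suc_UNIV_I[where D = "\<lambda>_. f"] bounded_linear_imp_has_derivative Ck_on_const)
qed (simp add: linear_continuous_on)

lemma Ck_on_compose_bounded_linear:
  assumes "bounded_linear L"
  shows "Ck_on k UNIV f \<Longrightarrow> Ck_on k UNIV (\<lambda>x. L (f x))"
proof (induction k arbitrary: f)
  case 0
  then show ?case using bounded_linear.continuous_on[OF assms] by simp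
next
  case (Suc k)
  show ?case
    by (rule Ck_on_Suc_UNIV_I[where D = "\<lambda>x v. L (frechet_derivative f (at x) v)"])
      (rule bounded_linear.has_derivative[OF assms] Ck_on_Suc_UNIV_D[OF Suc.prems] Suc.IH)+
qed

lemma Ck_on_add:
  "Ck_on k UNIV f \<Longrightarrow> Ck_on k UNIV g \<Longrightarrow> Ck_on k UNIV (\<lambda>x. f x + g x)"
proof (induction k arbitrary: f g)
  case 0
  then show ?case by (simp add: continuous_on_add)
next
  case (Suc k)
  show ?case
    by (rule Ck_on_Suc_UNIV_I[where
          D = "\<lambda>x v. frechet_derivative f (at x) v + frechet_derivative g (at x) v"])
      (rule has_derivative_add Ck_on_Suc_UNIV_D[OF Suc.prems(1)]
        Ck_on_Suc_UNIV_D[OF Suc.prems(2)] Suc.IH)+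
qed

lemma (in bounded_bilinear) Ck_on_prod:
  "Ck_on k UNIV f \<Longrightarrow> Ck_on k UNIV g \<Longrightarrow> Ck_on k UNIV (\<lambda>x. prod (f x) (g x))"
proof (induction k arbitrary: f g)
  case 0
  then show ?case by (simp add: continuous_on)
next
  case (Suc k)
  note Suc_k = Ck_on_Suc_imp_Ck_on[OF Suc.prems(1)] Ck_on_Suc_imp_Ck_on[OF Suc.prems(2)]
  show ?case
    by (rule Ck_on_Suc_UNIV_I[where D = "\<lambda>x v. prod (f x) (frechet_derivative g (at x) v) +
          prod (frechet_derivative f (at x) v) (g x)"])
      (rule FDERIV Ck_on_add Suc_k Ck_on_Suc_UNIV_D[OF Suc.prems(1)]
        Ck_on_Suc_UNIV_D[OF Suc.prems(2)] Suc.IH)+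
qed

lemma Ck_on_inverse:
  fixes f :: "'a::real_normed_vector \<Rightarrow> real"
  assumes nz: "\<And>x. f x \<noteq> 0"
  shows "Ck_on k UNIV f \<Longrightarrow> Ck_on k UNIV (\<lambda>x. inverse (f x))"
proof (induction k)
  case 0
  then show ?case using nz by (simp add: continuous_on_inverse)
next
  case (Suc k)
  have IH: "Ck_on k UNIV (\<lambda>x. inverse (f x))"
    by (rule Suc.IH) (rule Ck_on_Suc_imp_Ck_on[OF Suc.prems])
  show ?case
  proof (rule Ck_on_Suc_UNIV_I)
    show "((\<lambda>x. inverse (f x)) has_derivative
        (\<lambda>v. - (inverse (f x) * frechet_derivative f (at x) v * inverse (f x)))) (at x)" for x
      by (rule Deriv.has_derivative_inverse[OF nz Ck_on_Suc_UNIV_D(1)[OF Suc.prems]])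
    show "Ck_on k UNIV (\<lambda>x. - (inverse (f x) * frechet_derivative f (at x) v * inverse (f x)))" for v
      by (rule Ck_on_compose_bounded_linear[OF bounded_linear_minus[OF bounded_linear_ident]]
          bounded_bilinear.Ck_on_prod[OF bounded_bilinear_mult] IH Ck_on_Suc_UNIV_D(2)[OF Suc.prems])+
  qed
qed

section \<open>Conformal geometry of the inverse stereographic projection\<close>

lemma phi_pos [simp]: "phi x > 0"
  by (simp add: phi_def add_pos_nonneg)

lemma phi_nz [simp]: "phi x \<noteq> 0"
  using phi_pos[of x] by linarith

lemma norm_sq_phi: "(norm x)\<^sup>2 = 2 / phi x - 1"
  by (simp add: phi_def add_divide_distrib)

lemma phi_alt: "phi x = 2 * inverse (1 + x \<bullet> x)"
  by (simp add: phi_def divide_inverse power2_norm_eq_inner)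

lemma one_plus_inner_nz: "1 + x \<bullet> (x :: 'a::real_inner) \<noteq> 0"
  using inner_ge_zero[of x] by linarith

text \<open>This is the geometric form: start at the south pole and go along the direction
  \<open>(x, 1)\<close> towards \<open>(x, 0)\<close>, with parameter \<open>phi x\<close>.
  Derivatives and inner products are easier to compute from it.\<close>

lemma stereo_inv_alt: "stereo_inv x = phi x *\<^sub>R (x, 1) + (0, - 1)"
proof -
  have "1 + (norm x)\<^sup>2 \<noteq> 0" using one_plus_inner_nz[of x] by (simp add: power2_norm_eq_inner)
  then show ?thesis by (simp add: stereo_inv_def phi_def field_simps)
qed

lemma Ck_on_phi: "Ck_on k UNIV (phi :: real ^ 'n::finite \<Rightarrow> real)"
proof -
  have "Ck_on k UNIV (\<lambda>x :: real ^ 'n. 2 * inverse (1 + x \<bullet> x))"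
    by (rule Ck_on_compose_bounded_linear[OF bounded_linear_mult_right] Ck_on_inverse Ck_on_add
        one_plus_inner_nz Ck_on_const bounded_bilinear.Ck_on_prod[OF bounded_bilinear_inner]
        Ck_on_bounded_linear[OF bounded_linear_ident])+
  then show ?thesis by (simp add: phi_alt[abs_def])
qed

lemma Ck_on_stereo_inv: "Ck_on k UNIV (stereo_inv :: real ^ 'n::finite \<Rightarrow> 'n amb)"
proof -
  have "Ck_on k UNIV (\<lambda>x :: real ^ 'n. phi x *\<^sub>R ((x, 0) + (0, 1 :: real)) + (0, - 1))"
    by (rule Ck_on_add Ck_on_const Ck_on_phi bounded_bilinear.Ck_on_prod[OF bounded_bilinear_scaleR]
        Ck_on_bounded_linear[OF bounded_linear_Pair[OF bounded_linear_ident bounded_linear_zero]])+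
  then show ?thesis by (simp add: stereo_inv_alt[abs_def])
qed

lemma has_derivative_phi: "(phi has_derivative (\<lambda>v. - (phi x)\<^sup>2 * (x \<bullet> v))) (at x)"
proof -
  have "((\<lambda>x. 2 * inverse (1 + x \<bullet> x)) has_derivative (\<lambda>v. - (phi x)\<^sup>2 * (x \<bullet> v))) (at x)"
    by (rule derivative_eq_intros refl one_plus_inner_nz)+
      (simp add: phi_alt fun_eq_iff power2_eq_square inner_commute algebra_simps)
  then show ?thesis by (simp add: phi_alt[abs_def])
qed

definition stereo_inv_deriv :: "real ^ 'n::finite \<Rightarrow> real ^ 'n \<Rightarrow> 'n amb" where
  "stereo_inv_deriv x v = (- (phi x)\<^sup>2 * (x \<bullet> v)) *\<^sub>R (x, 1) + phi x *\<^sub>R (v, 0)"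

lemma has_derivative_stereo_inv: "(stereo_inv has_derivative stereo_inv_deriv x) (at x)"
proof -
  have "((\<lambda>x. phi x *\<^sub>R (x, 1) + (0, - 1)) has_derivative stereo_inv_deriv x) (at x)"
    by (rule derivative_eq_intros has_derivative_phi refl)+
      (simp add: fun_eq_iff stereo_inv_deriv_def)
  then show ?thesis by (simp add: stereo_inv_alt[abs_def])
qed

text \<open>Since \<open>(x, 1)\<close> has squared length \<open>2 / phi x\<close>, the square of
  the radial term of the derivative cancels against the two cross terms, leaving only the
  contribution of \<open>phi x *\<^sub>R (v, 0)\<close>.\<close>

lemma stereo_inv_conformal:
  "stereo_inv_deriv x v \<bullet> stereo_inv_deriv x w = (phi x)\<^sup>2 * (v \<bullet> w)"
proof -
  have "x \<bullet> x + 1 = 2 / phi x" using norm_sq_phi[of x] by (simp add: power2_norm_eq_inner)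
  then have e: "(phi x)\<^sup>2 * (phi x)\<^sup>2 * (x \<bullet> x + 1) = 2 * (phi x)\<^sup>2 * phi x"
    by (simp add: power2_eq_square)
  have "stereo_inv_deriv x v \<bullet> stereo_inv_deriv x w =
      ((phi x)\<^sup>2 * (phi x)\<^sup>2 * (x \<bullet> x + 1)) * (x \<bullet> v) * (x \<bullet> w)
      - 2 * (phi x)\<^sup>2 * phi x * (x \<bullet> v) * (x \<bullet> w) + (phi x)\<^sup>2 * (v \<bullet> w)"
    by (simp add: stereo_inv_deriv_def inner_simps inner_commute algebra_simps power2_eq_square)
  then show ?thesis unfolding e by simp
qed

lemma stereo_inv_inner: "stereo_inv x \<bullet> stereo_inv y = phi x * phi y * (x \<bullet> y + 1) - phi x - phi y + 1"
  by (simp add: stereo_inv_alt inner_simps algebra_simps)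

lemma norm_stereo_inv [simp]: "norm (stereo_inv x) = 1"
proof -
  have "x \<bullet> x + 1 = 2 / phi x" using norm_sq_phi[of x] by (simp add: power2_norm_eq_inner)
  then have "stereo_inv x \<bullet> stereo_inv x = 1" by (simp add: stereo_inv_inner)
  then show ?thesis by (simp add: norm_eq_1)
qed

lemma chordal_distance:
  "norm (stereo_inv x - stereo_inv y) = sqrt (phi x * phi y) * norm (x - y)"
proof -
  have s: "stereo_inv z \<bullet> stereo_inv z = 1" for z :: "real ^ 'a"
    by (metis norm_eq_1 norm_stereo_inv)
  have n: "z \<bullet> z = 2 / phi z - 1" for z :: "real ^ 'a"
    using norm_sq_phi[of z] by (simp add: power2_norm_eq_inner)
  have "(norm (stereo_inv x - stereo_inv y))\<^sup>2 = 2 - 2 * (stereo_inv x \<bullet> stereo_inv y)"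
    by (simp add: power2_norm_eq_inner inner_diff_left inner_diff_right s inner_commute)
  also have "\<dots> = phi x * phi y * (norm (x - y))\<^sup>2"
    by (simp add: stereo_inv_inner power2_norm_eq_inner inner_diff_left inner_diff_right n[of x] n[of y]
        inner_commute[of y x] field_simps)
  finally show ?thesis
    by (metis norm_ge_zero real_sqrt_mult real_sqrt_abs abs_of_nonneg)
qed

lemma inj_stereo_inv: "inj stereo_inv"
  by (metis injI stereo_stereo_inv)

lemma continuous_on_stereo_inv [continuous_intros]:
  "continuous_on S f \<Longrightarrow> continuous_on S (\<lambda>x. stereo_inv (f x))"
  using continuous_on_compose2[of UNIV stereo_inv S f] Ck_on_stereo_inv[of 0] by auto

lemma sphere_param_stereo_inv: "sphere_param UNIV (stereo_inv :: real ^ 'n::finite \<Rightarrow> 'n amb)"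
proof -
  have "frechet_derivative stereo_inv (at x) = stereo_inv_deriv x" for x :: "real ^ 'n"
    by (rule frechet_derivative_at[OF has_derivative_stereo_inv, symmetric])
  moreover have "inj (stereo_inv_deriv x)" for x :: "real ^ 'n"
  proof -
    have lin: "linear (stereo_inv_deriv x)"
      using has_derivative_linear[OF has_derivative_stereo_inv] .
    have "v = 0" if "stereo_inv_deriv x v = 0" for v
      using stereo_inv_conformal[of x v v] that by simp
    then show ?thesis using lin by (simp add: linear_injective_0)
  qed
  ultimately show ?thesis
    by (auto simp: sphere_param_def Cinf_on_def Ck_on_stereo_inv inj_stereo_inv)
qed

text \<open>A norm-preserving linear map is injective, keeps the sphere invariant and commutes with
  differentiation. This produces a chart around the south pole from
  \<open>stereo_inv\<close>.\<close>

lemma sphere_param_isometry: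
  fixes f :: "real ^ 'n \<Rightarrow> 'n::finite amb"
  assumes L: "bounded_linear L" "\<And>z. norm (L z) = norm z" and f: "sphere_param UNIV f"
  shows "sphere_param UNIV (\<lambda>x. L (f x))"
proof -
  interpret L: bounded_linear L by (rule L)
  have inj: "inj L" using L by (simp add: L.linear linear_injective_0) (metis norm_eq_zero)
  have "Ck_on 1 UNIV f" using f by (simp add: sphere_param_def Cinf_on_def)
  then have "((\<lambda>x. L (f x)) has_derivative (\<lambda>v. L (frechet_derivative f (at x) v))) (at x)" for x
    unfolding One_nat_def by (intro L.has_derivative Ck_on_Suc_UNIV_D(1))
  from frechet_derivative_at[OF this]
  have "frechet_derivative (\<lambda>x. L (f x)) (at x) = L \<circ> frechet_derivative f (at x)" for x
    by (simp add: o_def)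
  moreover have "inj_on (\<lambda>x. L (f x)) UNIV"
    using f inj_compose[OF inj, of f] by (simp add: sphere_param_def o_def)
  ultimately show ?thesis
    using f inj L(2)
    by (auto simp: sphere_param_def Cinf_on_def inj_compose image_subset_iff
        intro: Ck_on_compose_bounded_linear[OF L(1)])
qed

text \<open>Reflection in the equatorial hyperplane. Composed with \<open>stereo_inv\<close> it
  gives the inverse projection from the north pole, whose image contains the south pole.\<close>

definition reflect :: "'n::finite amb \<Rightarrow> 'n amb" where
  "reflect z = (fst z, - snd z)"

lemma bounded_linear_reflect: "bounded_linear reflect"
  unfolding reflect_def[abs_def]
  by (intro bounded_linear_Pair bounded_linear_fst bounded_linear_minus bounded_linear_snd)

lemma sphere_param_reflect: "sphere_param UNIV (\<lambda>x. reflect (stereo_inv x))"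
  by (rule sphere_param_isometry[OF bounded_linear_reflect _ sphere_param_stereo_inv])
    (simp add: reflect_def norm_prod_def)

section \<open>The round volume\<close>

lemma continuous_on_phi [continuous_intros]:
  "continuous_on S f \<Longrightarrow> continuous_on S (\<lambda>x. phi (f x))"
  using continuous_on_compose2[of UNIV phi S f] Ck_on_phi[of 0] by auto

lemma phi_measurable [measurable]: "phi \<in> borel_measurable borel"
  by (intro borel_measurable_continuous_onI continuous_intros)

lemma stereo_inv_borel [measurable]: "stereo_inv \<in> borel_measurable borel"
  by (intro borel_measurable_continuous_onI continuous_intros)

lemma stereo_inv_measurable [measurable]:
  "stereo_inv \<in> borel \<rightarrow>\<^sub>M restrict_space borel (sphere 0 1)"
  by (intro measurable_restrict_space2) auto

text \<open>The explicit candidate for the round volume: by conformality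
  \<open>phi x ^ CARD('n)\<close> is the square root of the Gram determinant in stereographic
  coordinates. The south pole receives mass zero.\<close>

definition sphere_measure :: "'n::finite amb measure" where
  "sphere_measure = distr (density lborel (\<lambda>x. ennreal (phi x ^ CARD('n))))
     (restrict_space borel (sphere 0 1)) stereo_inv"

lemma sets_sphere_borel:
  fixes A :: "'n::finite amb set"
  shows "A \<in> sets (restrict_space borel (sphere 0 1)) \<Longrightarrow> A \<in> sets borel"
  by (subst (asm) sets_restrict_space_iff) (auto intro: borel_closed)

lemma emeasure_sphere_measure:
  fixes A :: "'n::finite amb set"
  assumes A: "A \<in> sets (restrict_space borel (sphere 0 1))"
  shows "emeasure sphere_measure A
       = (\<integral>\<^sup>+y. ennreal (phi y ^ CARD('n)) * indicator (stereo_inv -` A) y \<partial>lborel)"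
  using A measurable_sets[OF stereo_inv_measurable A]
  by (simp add: sphere_measure_def emeasure_distr emeasure_density)

lemma stereo_inv_ne_south: "stereo_inv x \<noteq> (0, - 1)"
proof
  assume "stereo_inv x = (0, - 1)"
  then have "phi x *\<^sub>R (x, 1::real) = 0" unfolding stereo_inv_alt by (metis add_cancel_left_left)
  then show False by (simp add: zero_prod_def)
qed

lemma sphere_param_derivative:
  assumes "sphere_param U f" "x \<in> U"
  shows "(f has_derivative frechet_derivative f (at x)) (at x)"
proof -
  have "Ck_on 1 U f" using assms by (simp add: sphere_param_def Cinf_on_def)
  then show ?thesis using assms(2) by (simp add: frechet_derivative_works)
qed

lemma sphere_param_continuous: "sphere_param U f \<Longrightarrow> continuous_on U f"
  by (metis Ck_on.simps(1) Cinf_on_def sphere_param_def)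

lemma one_plus_snd_nz:
  fixes z :: "'n::finite amb"
  assumes "z \<in> sphere 0 1" "z \<noteq> (0, - 1)"
  shows "1 + snd z \<noteq> 0"
proof
  assume *: "1 + snd z = 0"
  then have "snd z = - 1" by (simp add: eq_neg_iff_add_eq_0 add.commute)
  moreover have "(norm (fst z))\<^sup>2 + (snd z)\<^sup>2 = 1"
    using assms(1) by (simp add: norm_prod_def real_sqrt_eq_1_iff)
  ultimately have "fst z = 0" by simp
  with \<open>snd z = - 1\<close> assms(2) show False by (metis prod.collapse)
qed

lemma stereo_differentiable:
  fixes z :: "'n::finite amb"
  assumes "1 + snd z \<noteq> 0"
  shows "stereo differentiable (at z)"
  unfolding stereo_def[abs_def] using assms
  by (intro derivative_intros bounded_linear_imp_differentiable bounded_linear_fst bounded_linear_snd)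

lemma det_gram:
  fixes D :: "real ^ 'n::finite \<Rightarrow> real ^ 'n"
  shows "det (\<chi> i j. D (axis i 1) \<bullet> D (axis j 1)) = (det (matrix D))\<^sup>2"
proof -
  have "(\<chi> i j. D (axis i 1) \<bullet> D (axis j 1)) = transpose (matrix D) ** matrix D"
    by (simp add: vec_eq_iff matrix_matrix_mult_def transpose_def matrix_def inner_vec_def)
  then show ?thesis by (simp add: det_mul det_transpose power2_eq_square)
qed

text \<open>The hypothesis says that \<open>f\<close> has the same Gram matrix at \<open>x\<close>
  as the square matrix of \<open>c\<close> times \<open>D\<close>, and \<open>det_gram\<close> makes
  the Gram determinant the square of an ordinary one.\<close>

lemma metric_matrix_eq:
  fixes f :: "real ^ 'n::finite \<Rightarrow> 'n amb"
  assumes "\<And>v w. frechet_derivative f (at x) v \<bullet> frechet_derivative f (at x) w = c\<^sup>2 * (D v \<bullet> D w)"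
    and lin: "linear D" and c: "c \<ge> 0"
  shows "sqrt (det (metric_matrix f x)) = c ^ CARD('n) * \<bar>det (matrix D)\<bar>"
proof -
  define E where "E = matrix ((*\<^sub>R) c \<circ> D)"
  have sc: "linear ((*\<^sub>R) c :: real ^ 'n \<Rightarrow> real ^ 'n)"
    by (intro linearI) (auto simp: scaleR_add_right)
  have "det (metric_matrix f x) = (det E)\<^sup>2"
    unfolding E_def det_gram[symmetric]
    by (simp add: metric_matrix_def assms(1) power2_eq_square mult.assoc)
  moreover have "det E = c ^ CARD('n) * det (matrix D)"
    by (simp add: E_def matrix_compose[OF lin sc] det_mul)
  ultimately show ?thesis using c by (simp add: abs_mult)
qed

text \<open>Away from the south pole \<open>f\<close> is \<open>stereo_inv\<close> after the
  transition map \<open>stereo o f\<close>. The chain rule and conformality then split the density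
  of an arbitrary chart into \<open>phi ^ CARD('n)\<close> and the Jacobian of the transition
  map.\<close>

lemma round_density_in_chart:
  fixes f :: "real ^ 'n::finite \<Rightarrow> 'n amb"
  assumes f: "sphere_param U f" and x: "x \<in> U" "f x \<noteq> (0, - 1)"
  shows "\<exists>D. ((\<lambda>y. stereo (f y)) has_derivative D) (at x) \<and>
    sqrt (det (metric_matrix f x)) = phi (stereo (f x)) ^ CARD('n) * \<bar>det (matrix D)\<bar>"
proof -
  let ?\<tau> = "\<lambda>y. stereo (f y)"
  have sphere: "f y \<in> sphere 0 1" if "y \<in> U" for y
    using f that by (auto simp: sphere_param_def)
  have "open U" using f by (simp add: sphere_param_def)
  obtain S where S: "(stereo has_derivative S) (at (f x))"
    using stereo_differentiable[OF one_plus_snd_nz[OF sphere x(2)]] x(1)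
    by (auto simp: differentiable_def)
  define D where "D = S \<circ> frechet_derivative f (at x)"
  have D: "(?\<tau> has_derivative D) (at x)"
    using diff_chain_at[OF sphere_param_derivative[OF f x(1)] S] by (simp add: D_def o_def)
  have "((\<lambda>y. stereo_inv (?\<tau> y)) has_derivative stereo_inv_deriv (?\<tau> x) \<circ> D) (at x)"
    using diff_chain_at[OF D has_derivative_stereo_inv] by (simp add: o_def)
  note chart = this
  \<comment> \<open>The factorization holds only off the south pole; this set being open, it still
    determines the derivative at \<open>x\<close>.\<close>
  have op: "open (U \<inter> f -` (- {(0, - 1)}))"
    by (intro continuous_open_preimage sphere_param_continuous[OF f] \<open>open U\<close>) auto
  have inv: "stereo_inv (?\<tau> y) = f y" if "y \<in> U \<inter> f -` (- {(0, - 1)})" for y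
    using that by (auto intro: stereo_inv_stereo[OF sphere])
  have "(f has_derivative stereo_inv_deriv (?\<tau> x) \<circ> D) (at x)"
    by (rule has_derivative_transform_within_open[OF chart op _ inv]) (use x in simp_all)
  then have "frechet_derivative f (at x) = stereo_inv_deriv (?\<tau> x) \<circ> D"
    by (rule frechet_derivative_at[symmetric])
  then have "sqrt (det (metric_matrix f x)) = phi (?\<tau> x) ^ CARD('n) * \<bar>det (matrix D)\<bar>"
    using has_derivative_linear[OF D]
    by (intro metric_matrix_eq) (simp_all add: stereo_inv_conformal less_imp_le)
  with D show ?thesis by blast
qed

lemma continuous_on_round_density:
  fixes f :: "real ^ 'n::finite \<Rightarrow> 'n amb"
  assumes "sphere_param U f"
  shows "continuous_on U (\<lambda>x. sqrt (det (metric_matrix f x)))"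
proof -
  have "Ck_on 1 U f" using assms by (simp add: sphere_param_def Cinf_on_def)
  then have "continuous_on U (\<lambda>x. frechet_derivative f (at x) v)" for v by simp
  then show ?thesis
    unfolding det_def metric_matrix_def by (auto intro!: continuous_intros)
qed

text \<open>By \<open>round_density_in_chart\<close>, the volume formula in a chart \<open>f\<close>
  is the change of variables \<open>y = stereo (f x)\<close> in the definition of
  \<open>sphere_measure\<close>.\<close>

lemma is_round_volume_sphere_measure: "is_round_volume (sphere_measure :: 'n::finite amb measure)"
  unfolding is_round_volume_def
proof (intro conjI allI impI)
  show sets: "sets (sphere_measure :: 'n amb measure) = sets (restrict_space borel (sphere 0 1))"
    by (simp add: sphere_measure_def)
  fix U :: "(real ^ 'n) set" and f and A :: "'n amb set"
  assume f: "sphere_param U f" and "A \<in> sets sphere_measure" and AU: "A \<subseteq> f ` U"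
  then have A: "A \<in> sets (restrict_space borel (sphere 0 1))" by (simp add: sets)
  note Ab = sets_sphere_borel[OF A]
  have U: "open U" "inj_on f U" using f by (auto simp: sphere_param_def)
  have sphere: "f y \<in> sphere 0 1" if "y \<in> U" for y
    using f that by (auto simp: sphere_param_def)
  let ?s = "(0, - 1) :: 'n amb"
  let ?g = "\<lambda>x. stereo (f x)" and ?d = "\<lambda>x. sqrt (det (metric_matrix f x))"
  define T where "T = U \<inter> f -` (A - {?s})"
  have T [measurable]: "T \<in> sets borel"
  proof -
    have "f -` (A - {?s}) \<inter> space (restrict_space borel U) \<in> sets (restrict_space borel U)"
      by (intro measurable_sets[OF borel_measurable_continuous_on_restrict]
          sphere_param_continuous[OF f]) (use Ab in simp)
    then show ?thesis using U
      by (subst (asm) sets_restrict_space_iff) (auto simp: T_def space_restrict_space Int_commute)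
  qed
  have inv: "stereo_inv (?g x) = f x" if "x \<in> T" for x
    using that by (intro stereo_inv_stereo sphere) (auto simp: T_def)
  have gT: "?g ` T = stereo_inv -` A"
  proof (intro set_eqI iffI)
    fix y assume "y \<in> stereo_inv -` A"
    then obtain x where "x \<in> U" "f x = stereo_inv y" using AU by (metis imageE subsetD vimageE)
    then show "y \<in> ?g ` T" using \<open>y \<in> stereo_inv -` A\<close> stereo_inv_ne_south[of y]
      by (intro image_eqI[of _ _ x]) (auto simp: T_def stereo_stereo_inv)
  next
    fix y assume "y \<in> ?g ` T"
    then obtain x where "x \<in> T" "y = ?g x" by blast
    then show "y \<in> stereo_inv -` A" using inv[of x] by (simp add: T_def)
  qed
  \<comment> \<open>The Jacobian of the transition map, recovered by dividing the two densities. In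
    this form it is visibly continuous on \<open>T\<close>, hence Borel after extension by
    zero.\<close>
  define J where "J x = (if x \<in> T then ?d x / phi (?g x) ^ CARD('n) else 0)" for x
  have gT_cont: "continuous_on T ?g"
  proof (rule continuous_at_imp_continuous_on, rule ballI)
    fix x assume "x \<in> T"
    then show "isCont ?g x"
      using round_density_in_chart[OF f, of x] by (auto simp: T_def intro: has_derivative_continuous)
  qed
  have TU: "T \<subseteq> U" by (auto simp: T_def)
  have J: "J \<in> borel_measurable borel"
    unfolding J_def using T gT_cont continuous_on_subset[OF continuous_on_round_density[OF f] TU]
    by (subst measurable_restrict_space_iff[symmetric])
      (auto intro!: borel_measurable_continuous_on_restrict continuous_intros)
  have "\<exists>D. \<forall>x\<in>T. (?g has_derivative D x) (at x) \<and> ?d x = phi (?g x) ^ CARD('n) * \<bar>det (matrix (D x))\<bar>"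
    using round_density_in_chart[OF f] by (intro bchoice) (auto simp: T_def)
  then obtain D where D: "\<And>x. x \<in> T \<Longrightarrow> (?g has_derivative D x) (at x)"
    "\<And>x. x \<in> T \<Longrightarrow> ?d x = phi (?g x) ^ CARD('n) * \<bar>det (matrix (D x))\<bar>" by blast
  \<comment> \<open>The south pole, which \<open>stereo_inv\<close> misses, is hit by at most one parameter.\<close>
  have "finite (f -` {?s} \<inter> U)" by (intro finite_vimage_IntI U) simp
  then have null: "AE x in lborel. x \<notin> f -` {?s} \<inter> U"
    by (intro AE_not_in finite_imp_null_set_lborel)
  have "emeasure sphere_measure A
      = (\<integral>\<^sup>+y. ennreal (phi y ^ CARD('n)) * indicator (?g ` T) y \<partial>lborel)"
    by (simp add: emeasure_sphere_measure[OF A] gT)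
  also have "\<dots> = (\<integral>\<^sup>+x. ennreal (J x) * ennreal (phi (?g x) ^ CARD('n)) * indicator T x \<partial>lborel)"
  proof (rule nn_integral_change_of_variables[OF T])
    show "?g ` T \<in> sets borel" unfolding gT using measurable_sets[OF stereo_inv_borel Ab] by simp
    show "(?g has_derivative D x) (at x within T)" if "x \<in> T" for x
      using D(1)[OF that] by (rule has_derivative_at_withinI)
    show "inj_on ?g T"
      by (rule inj_onI) (metis TU U(2) inj_onD inv subsetD)
    show "J x = \<bar>det (matrix (D x))\<bar>" if "x \<in> T" for x
      using that D(2) by (simp add: J_def)
  qed (use J in measurable)
  also have "\<dots> = (\<integral>\<^sup>+x. ennreal (?d x) * indicator T x \<partial>lborel)"
    by (rule nn_integral_cong)
      (auto simp: J_def ennreal_mult'' [symmetric] less_imp_le split: split_indicator)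
  also have "\<dots> = (\<integral>\<^sup>+x\<in>U. ennreal (?d x) * indicator A (f x) \<partial>lborel)"
    using null by (intro nn_integral_cong_AE) (auto simp: T_def elim!: eventually_mono split: split_indicator)
  finally show "emeasure sphere_measure A
      = (\<integral>\<^sup>+x\<in>U. ennreal (?d x) * indicator A (f x) \<partial>lborel)" .
qed

text \<open>The defining property prescribes the measure of sets inside a single chart. Two charts
  cover the sphere: \<open>stereo_inv\<close> handles everything but the south pole, and the
  reflected chart handles the pole, its value at the origin.\<close>

lemma is_round_volume_unique:
  fixes M M' :: "'n::finite amb measure"
  assumes M: "is_round_volume M" and M': "is_round_volume M'"
  shows "M = M'"
proof (rule measure_eqI)
  show sets: "sets M = sets M'" using M M' by (simp add: is_round_volume_def)
  fix A assume A: "A \<in> sets M"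
  have eq: "emeasure M B = emeasure M' B" if "sphere_param UNIV f" "B \<subseteq> range f" "B \<in> sets M"
    for f and B :: "'n amb set"
    using M M' that sets by (simp add: is_round_volume_def)
  let ?s = "(0, - 1) :: 'n amb"
  have setsM: "sets M = sets (restrict_space borel (sphere 0 1))"
    using M by (simp add: is_round_volume_def)
  have "{?s} \<in> sets M"
    unfolding setsM by (subst sets_restrict_space_iff) (auto simp: norm_prod_def)
  with A have parts: "A - {?s} \<in> sets M" "A \<inter> {?s} \<in> sets M" by auto
  have "A \<subseteq> sphere 0 1"
    using sets.sets_into_space[OF A] sets_eq_imp_space_eq[OF setsM]
    by (simp add: space_restrict_space)
  then have "stereo_inv (stereo z) = z" if "z \<in> A - {?s}" for z
    using that by (intro stereo_inv_stereo) auto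
  then have "A - {?s} \<subseteq> range stereo_inv" by (metis rangeI subsetI)
  then have 1: "emeasure M (A - {?s}) = emeasure M' (A - {?s})"
    by (rule eq[OF sphere_param_stereo_inv _ parts(1)])
  have "?s = reflect (stereo_inv 0)" by (simp add: reflect_def stereo_inv_def)
  then have "A \<inter> {?s} \<subseteq> range (\<lambda>x. reflect (stereo_inv x))" by blast
  then have 2: "emeasure M (A \<inter> {?s}) = emeasure M' (A \<inter> {?s})"
    by (rule eq[OF sphere_param_reflect _ parts(2)])
  have "emeasure K A = emeasure K (A - {?s}) + emeasure K (A \<inter> {?s})" if "sets K = sets M" for K
  proof -
    have "emeasure K (A - {?s}) + emeasure K (A \<inter> {?s}) = emeasure K ((A - {?s}) \<union> (A \<inter> {?s}))"
      by (rule plus_emeasure) (use parts that in simp_all, blast)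
    moreover have "(A - {?s}) \<union> (A \<inter> {?s}) = A" by blast
    ultimately show ?thesis by simp
  qed
  then show "emeasure M A = emeasure M' A" using 1 2 sets by simp
qed

lemma round_volume_eq: "round_volume = sphere_measure"
  unfolding round_volume_def
  by (rule the_equality) (auto intro: is_round_volume_sphere_measure is_round_volume_unique)

section \<open>Radial integrals\<close>

text \<open>Polar coordinates for radial functions: the half-lines \<open>{..R}\<close> generate the
  Borel sets, their preimages are balls, and differentiating the volume
  \<open>unit_ball_vol N * R ^ N\<close> gives the density.\<close>

lemma distr_norm_lborel:
  "distr (lborel :: 'a::euclidean_space measure) borel norm =
   density lborel (\<lambda>r. ennreal (real DIM('a) * unit_ball_vol DIM('a) * r ^ (DIM('a) - 1)) * indicator {0..} r)"
  (is "?L = density lborel ?d")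
proof (rule measure_eqI_generator_eq)
  let ?N = "DIM('a)" and ?\<omega> = "unit_ball_vol (real DIM('a))"
  let ?E = "range (\<lambda>a::real. {..a})"
  show "Int_stable ?E" by (auto simp: Int_stable_def)
  show "?E \<subseteq> Pow UNIV" "sets ?L = sigma_sets UNIV ?E" "sets (density lborel ?d) = sigma_sets UNIV ?E"
    by (auto simp: borel_eq_atMost)
  show "range (\<lambda>n::nat. {..real n}) \<subseteq> ?E" by auto
  show "(\<Union>n::nat. {..real n}) = UNIV" using real_arch_simple by auto
  have ball: "emeasure ?L {..R} = emeasure lborel (cball (0::'a) R)" for R
    by (simp add: emeasure_distr vimage_def cball_def dist_norm)
  then show "emeasure ?L {..real n} \<noteq> \<infinity>" for n by (simp add: emeasure_cball)
  fix X assume "X \<in> ?E"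
  then obtain R where X: "X = {..R}" by auto
  show "emeasure ?L X = emeasure (density lborel ?d) X"
  proof (cases "R \<ge> 0")
    case True
    have "(\<integral>\<^sup>+r. ennreal (real ?N * ?\<omega> * r ^ (?N - 1)) * indicator {0..R} r \<partial>lborel)
        = ennreal (?\<omega> * R ^ ?N - ?\<omega> * 0 ^ ?N)"
      by (rule nn_integral_FTC_Icc[where F = "\<lambda>r. ?\<omega> * r ^ ?N"])
        (auto intro!: derivative_eq_intros simp: True)
    moreover have "(\<integral>\<^sup>+r. ennreal (real ?N * ?\<omega> * r ^ (?N - 1)) * indicator {0..R} r \<partial>lborel)
        = emeasure (density lborel ?d) {..R}"
      by (subst emeasure_density, simp, simp, rule nn_integral_cong) (simp split: split_indicator)
    ultimately show ?thesis
      unfolding X ball by (simp add: emeasure_cball True zero_power)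
  next
    case False
    have "emeasure (density lborel ?d) {..R} = (\<integral>\<^sup>+r. 0 \<partial>(lborel :: real measure))"
      by (subst emeasure_density, simp, simp, rule nn_integral_cong)
        (use False in \<open>simp split: split_indicator\<close>)
    then show ?thesis unfolding X ball using False by simp
  qed
qed

text \<open>\<open>h\<close> is a regular version of \<open>r ^ (DIM('a) - 1) * k r\<close>. The two
  need agree only for \<open>r > a\<close>, so \<open>k\<close> may be singular, or have an
  artificial value, at the inner radius, while the fundamental theorem of calculus is applied to
  \<open>h\<close> on the closed interval.\<close>

lemma nn_integral_shell:
  fixes k h H :: "real \<Rightarrow> real"
  assumes "0 \<le> a" "a \<le> R" and k [measurable]: "k \<in> borel_measurable borel"
    and h [measurable]: "h \<in> borel_measurable borel" and h0: "\<And>r. a \<le> r \<Longrightarrow> r \<le> R \<Longrightarrow> 0 \<le> h r"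
    and H: "\<And>r. a \<le> r \<Longrightarrow> r \<le> R \<Longrightarrow> (H has_real_derivative h r) (at r)"
    and kh: "\<And>r. a < r \<Longrightarrow> r \<le> R \<Longrightarrow> r ^ (DIM('a) - 1) * k r = h r"
  shows "(\<integral>\<^sup>+q. ennreal (k (norm q)) * indicator {a..R} (norm q) \<partial>(lborel :: 'a::euclidean_space measure))
       = ennreal (real DIM('a) * unit_ball_vol DIM('a) * (H R - H a))"
proof -
  let ?N = "DIM('a)" and ?\<omega> = "unit_ball_vol (real DIM('a))"
  have "(\<integral>\<^sup>+q. ennreal (k (norm q)) * indicator {a..R} (norm q) \<partial>(lborel :: 'a measure))
      = (\<integral>\<^sup>+r. ennreal (k r) * indicator {a..R} r \<partial>distr (lborel :: 'a measure) borel norm)"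
    by (subst nn_integral_distr) auto
  also have "\<dots> = (\<integral>\<^sup>+r. ennreal (real ?N * ?\<omega> * r ^ (?N - 1)) * indicator {0..} r *
      (ennreal (k r) * indicator {a..R} r) \<partial>lborel)"
    unfolding distr_norm_lborel by (subst nn_integral_density) auto
  also have "\<dots> = (\<integral>\<^sup>+r. ennreal (real ?N * ?\<omega> * h r) * indicator {a..R} r \<partial>lborel)"
  proof (rule nn_integral_cong_AE)
    have "AE r in lborel. r \<noteq> a" by (rule AE_lborel_singleton)
    then show "AE r in lborel. ennreal (real ?N * ?\<omega> * r ^ (?N - 1)) * indicator {0..} r *
      (ennreal (k r) * indicator {a..R} r) = ennreal (real ?N * ?\<omega> * h r) * indicator {a..R} r"
    proof (rule eventually_mono)
      fix r :: real assume "r \<noteq> a"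
      then show "ennreal (real ?N * ?\<omega> * r ^ (?N - 1)) * indicator {0..} r *
          (ennreal (k r) * indicator {a..R} r) = ennreal (real ?N * ?\<omega> * h r) * indicator {a..R} r"
        using kh[of r] assms(1)
        by (auto simp: ennreal_mult' [symmetric] mult.assoc split: split_indicator)
    qed
  qed
  also have "\<dots> = ennreal (real ?N * ?\<omega> * H R - real ?N * ?\<omega> * H a)"
    by (rule nn_integral_FTC_Icc[where F = "\<lambda>r. real ?N * ?\<omega> * H r"])
      (auto intro!: DERIV_cmult H assms(2) mult_nonneg_nonneg h0)
  finally show ?thesis by (simp add: right_diff_distrib)
qed

lemma has_bochner_integral_shell:
  fixes k h H :: "real \<Rightarrow> real"
  assumes "0 \<le> a" "a \<le> R" and k [measurable]: "k \<in> borel_measurable borel"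
    and k0: "\<And>r. a \<le> r \<Longrightarrow> r \<le> R \<Longrightarrow> 0 \<le> k r"
    and "h \<in> borel_measurable borel" and h0: "\<And>r. a \<le> r \<Longrightarrow> r \<le> R \<Longrightarrow> 0 \<le> h r"
    and H: "\<And>r. a \<le> r \<Longrightarrow> r \<le> R \<Longrightarrow> (H has_real_derivative h r) (at r)"
    and "\<And>r. a < r \<Longrightarrow> r \<le> R \<Longrightarrow> r ^ (DIM('a) - 1) * k r = h r"
  shows "has_bochner_integral (lborel :: 'a::euclidean_space measure)
    (\<lambda>q. indicator {a..R} (norm q) * k (norm q)) (real DIM('a) * unit_ball_vol DIM('a) * (H R - H a))"
proof (rule has_bochner_integral_nn_integral)
  have "H a \<le> H R"
    using \<open>a \<le> R\<close> by (rule DERIV_nonneg_imp_nondecreasing) (use H h0 in blast)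
  then show "0 \<le> real DIM('a) * unit_ball_vol DIM('a) * (H R - H a)" by simp
  have "(\<integral>\<^sup>+q. ennreal (indicator {a..R} (norm q) * k (norm q)) \<partial>(lborel :: 'a measure))
      = (\<integral>\<^sup>+q. ennreal (k (norm q)) * indicator {a..R} (norm q) \<partial>(lborel :: 'a measure))"
    by (rule nn_integral_cong) (simp split: split_indicator)
  then show "(\<integral>\<^sup>+q. ennreal (indicator {a..R} (norm q) * k (norm q)) \<partial>(lborel :: 'a measure))
      = ennreal (real DIM('a) * unit_ball_vol DIM('a) * (H R - H a))"
    using nn_integral_shell[where 'a = 'a, OF assms(1,2,3,5-8)] by simp
  show "AE q in lborel. 0 \<le> indicator {a..R} (norm q) * k (norm (q :: 'a))"
    using k0 by (intro AE_I2) (auto split: split_indicator)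
qed measurable

text \<open>\<open>real N * unit_ball_vol (real N)\<close> is the area of the unit sphere of R^N,
  that is \<open>2 * pi powr (N / 2) / Gamma (N / 2)\<close>. The value 2 is the source of the
  factor in \<open>2 * ln (phi x)\<close>.\<close>

lemma c_const_sphere_area: "N > 0 \<Longrightarrow> c_const N * (real N * unit_ball_vol (real N)) = 2"
proof -
  assume N: "N > 0"
  have "Gamma (real N / 2 + 1) = real N / 2 * Gamma (real N / 2)"
    using N by (intro Gamma_plus1) (auto elim!: nonpos_Ints_cases)
  moreover have "Gamma (real N / 2) > 0" using N by (intro Gamma_real_pos) simp
  moreover have "Gamma (real N / 2 + 1) > 0" by (intro Gamma_real_pos) simp
  moreover have "a * (n / b) = 2" if "b = n / 2 * a" "b > 0" for a b n :: real
    using that by (simp add: field_simps)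
  ultimately have "Gamma (real N / 2) * (real N / Gamma (real N / 2 + 1)) = 2" by blast
  moreover have "pi powr (- real N / 2) * pi powr (real N / 2) = 1"
    by (simp add: powr_add[symmetric])
  moreover have "c_const N * (real N * unit_ball_vol (real N)) =
      (pi powr (- real N / 2) * pi powr (real N / 2)) *
      (Gamma (real N / 2) * (real N / Gamma (real N / 2 + 1)))"
    by (simp add: c_const_def unit_ball_vol_def)
  ultimately show ?thesis by simp
qed

section \<open>Radial primitives and the digamma function\<close>

lemma power2_powr_half:
  fixes r :: real
  assumes r: "r > 0"
  shows "(r\<^sup>2) powr (real N / 2) = r ^ N"
proof -
  have "(r\<^sup>2) powr (real N / 2) = (r powr real 2) powr (real N / 2)"
    by (simp only: powr_realpow[OF r])
  also have "\<dots> = r powr real N" by (simp add: powr_powr)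
  finally show ?thesis by (simp only: powr_realpow[OF r])
qed

lemma divide_powr_half: "(m / l) powr (h / 2) = m powr (h / 2) * l powr (- h / 2)"
  for m l h :: real
  using powr_minus_divide[of l "h / 2"] by (simp add: powr_divide)

text \<open>Integration by parts lowers the dimension by two; this matches \<open>Digamma (z + 1) = Digamma z + 1 / z\<close>
  at half-integers, and the one- and two-dimensional primitives are explicit.\<close>

lemma ex_radial_primitive_Suc:
  "\<exists>H. H 0 = (0::real) \<and>
    (\<forall>r. (H has_real_derivative r ^ N * (1 + r\<^sup>2) powr (- real (Suc N) / 2)) (at r)) \<and>
    ((\<lambda>R. H R - ln R) \<longlongrightarrow> - (Digamma (real (Suc N) / 2) + euler_mascheroni) / 2) at_top"
proof (induction N rule: induct_nat_012)
  case 0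
  have pos: "0 < 1 + r\<^sup>2" for r :: real by (simp add: add_pos_nonneg)
  \<comment> \<open>Dimension one. The limit fits because
    \<open>Digamma (1 / 2) = - 2 * ln 2 - euler_mascheroni\<close>.\<close>
  have "((\<lambda>R::real. arsinh R - ln R) \<longlongrightarrow> ln 2) at_top"
    unfolding arsinh_real_def by real_asymp
  moreover have "(arsinh has_real_derivative (1 + r\<^sup>2) powr (- 1 / 2)) (at r)" for r :: real
    using arsinh_real_has_field_derivative[of r UNIV] pos[of r]
    by (simp add: powr_minus powr_half_sqrt inverse_eq_divide add.commute)
  ultimately show ?case
    by (intro exI[of _ arsinh]) (simp add: Digamma_one_half)
next
  case 1
  have pos: "0 < 1 + r\<^sup>2" for r :: real by (simp add: add_pos_nonneg)
  \<comment> \<open>Dimension two, where \<open>Digamma 1 = - euler_mascheroni\<close> makes the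
    limit zero.\<close>
  have "((\<lambda>R::real. ln (1 + R\<^sup>2) / 2 - ln R) \<longlongrightarrow> 0) at_top" by real_asymp
  moreover have "((\<lambda>r. ln (1 + r\<^sup>2) / 2) has_real_derivative r * (1 + r\<^sup>2) powr - 1) (at r)" for r :: real
  proof -
    have "((\<lambda>r. ln (1 + r\<^sup>2) / 2) has_real_derivative (1 / (1 + r\<^sup>2) * (2 * r)) / 2) (at r)"
      by (rule DERIV_cdivide DERIV_ln_divide[THEN DERIV_chain2] pos)+
        (auto intro!: derivative_eq_intros)
    moreover have "(1 / s * (2 * r)) / 2 = r * (1 / s)" for s by simp
    then have "(1 / (1 + r\<^sup>2) * (2 * r)) / 2 = r * (1 + r\<^sup>2) powr - 1"
      unfolding powr_neg_one[OF pos[of r]] by blast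
    ultimately show ?thesis by simp
  qed
  ultimately show ?case
    by (intro exI[of _ "\<lambda>r. ln (1 + r\<^sup>2) / 2"]) simp
next
  case (ge2 n)
  have pos: "0 < 1 + r\<^sup>2" for r :: real by (simp add: add_pos_nonneg)
  let ?N = "Suc n"
  obtain H where H: "H 0 = 0"
    "\<And>r. (H has_real_derivative r ^ n * (1 + r\<^sup>2) powr (- real ?N / 2)) (at r)"
    "((\<lambda>R. H R - ln R) \<longlongrightarrow> - (Digamma (real ?N / 2) + euler_mascheroni) / 2) at_top"
    using ge2(1) by blast
  \<comment> \<open>The subtracted quotient is the boundary term of the integration by parts. It
    tends to \<open>1 / real ?N\<close>, which is half the increment of \<open>Digamma\<close> from
    \<open>real ?N / 2\<close> to \<open>real (n + 3) / 2\<close>.\<close>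
  define G where "G r = H r - r ^ ?N * (1 + r\<^sup>2) powr (- real ?N / 2) / real ?N" for r
  have "(G has_real_derivative r ^ (n + 2) * (1 + r\<^sup>2) powr (- real (n + 3) / 2)) (at r)" for r
  proof -
    define e where "e = - real ?N / 2"
    define t where "t = (1 + r\<^sup>2) powr (e - 1)"
    have t: "(1 + r\<^sup>2) powr e = (1 + r\<^sup>2) * t"
      using pos[of r] by (simp add: t_def powr_diff)
    have "((\<lambda>r. 1 + r\<^sup>2) has_real_derivative 2 * r) (at r)"
      by (auto intro!: derivative_eq_intros)
    then have d: "((\<lambda>r. (1 + r\<^sup>2) powr e) has_real_derivative e * t * (2 * r)) (at r)"
      unfolding t_def using pos[of r] by (intro DERIV_chain2[OF has_real_derivative_powr])
    have "(G has_real_derivative r ^ n * (1 + r\<^sup>2) powr e -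
        (real ?N * r ^ (?N - Suc 0) * (1 + r\<^sup>2) powr e + e * t * (2 * r) * r ^ ?N) / real ?N) (at r)"
      unfolding G_def e_def[symmetric]
      by (intro DERIV_diff DERIV_cdivide DERIV_mult DERIV_pow d H(2)[unfolded e_def[symmetric]])
    moreover have "r ^ n * (1 + r\<^sup>2) powr e -
        (real ?N * r ^ (?N - Suc 0) * (1 + r\<^sup>2) powr e + e * t * (2 * r) * r ^ ?N) / real ?N
        = r ^ (n + 2) * t"
      unfolding t by (simp add: e_def field_simps power2_eq_square del: of_nat_Suc)
    moreover have "e - 1 = - real (n + 3) / 2" by (simp add: e_def field_simps)
    ultimately show ?thesis unfolding t_def by simp
  qed
  moreover have "((\<lambda>R. G R - ln R) \<longlongrightarrow> - (Digamma (real (n + 3) / 2) + euler_mascheroni) / 2) at_top"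
  proof -
    have "((\<lambda>R. (R\<^sup>2 / (1 + R\<^sup>2)) powr (real ?N / 2)) \<longlongrightarrow> 1 powr (real ?N / 2)) at_top"
    proof (rule tendsto_powr)
      show "((\<lambda>R::real. R\<^sup>2 / (1 + R\<^sup>2)) \<longlongrightarrow> 1) at_top" by real_asymp
    qed auto
    moreover have "eventually (\<lambda>R. (R\<^sup>2 / (1 + R\<^sup>2)) powr (real ?N / 2)
        = R ^ ?N * (1 + R\<^sup>2) powr (- real ?N / 2)) at_top"
      using eventually_gt_at_top[of 0]
    proof eventually_elim
      case (elim R)
      then have "(R\<^sup>2) powr (real ?N / 2) = R ^ ?N" by (rule power2_powr_half)
      then show ?case by (simp only: divide_powr_half)
    qed
    ultimately have "((\<lambda>R. R ^ ?N * (1 + R\<^sup>2) powr (- real ?N / 2)) \<longlongrightarrow> 1) at_top"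
      by (simp add: tendsto_cong del: of_nat_Suc power_Suc)
    from tendsto_diff[OF H(3) tendsto_divide[OF this tendsto_const, of "real ?N"]]
    have "((\<lambda>R. G R - ln R) \<longlongrightarrow>
        - (Digamma (real ?N / 2) + euler_mascheroni) / 2 - 1 / real ?N) at_top"
      by (simp add: G_def algebra_simps del: of_nat_Suc power_Suc)
    moreover have "Digamma (real (n + 3) / 2) = Digamma (real ?N / 2) + 2 / real ?N"
      using Digamma_plus1[of "real ?N / 2"] by (simp add: field_simps)
    moreover have "- (d + 2 / x + c) / 2 = - (d + c) / 2 - 1 / x" for c d x :: real
      by (simp add: add_divide_distrib diff_divide_distrib)
    ultimately show ?thesis by (simp only:)
  qed
  moreover have "G 0 = 0" using H(1) by (simp add: G_def)
  ultimately show ?case by (intro exI[of _ G]) (simp add: add.commute)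
qed

lemma ex_radial_primitive:
  assumes "N > 0"
  shows "\<exists>H. H 0 = (0::real) \<and>
    (\<forall>r. (H has_real_derivative r ^ (N - 1) * (1 + r\<^sup>2) powr (- real N / 2)) (at r)) \<and>
    ((\<lambda>R. H R - ln R) \<longlongrightarrow> - (Digamma (real N / 2) + euler_mascheroni) / 2) at_top"
  using ex_radial_primitive_Suc[of "N - 1"] assms by simp

section \<open>Inversion\<close>

text \<open>At the origin the value is 0 because \<open>inverse 0 = 0\<close>, which makes this an
  involution of the whole space.\<close>

definition inversion :: "'a::real_inner \<Rightarrow> 'a" where
  "inversion q = q /\<^sub>R (norm q)\<^sup>2"

lemma norm_inversion [simp]: "norm (inversion q) = inverse (norm q)"
  by (cases "q = 0") (simp_all add: inversion_def power2_eq_square)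

lemma inversion_eq_0_iff [simp]: "inversion q = 0 \<longleftrightarrow> q = 0"
  by (simp add: inversion_def)

lemma inversion_inversion [simp]: "inversion (inversion q) = q"
proof (cases "q = 0")
  case False
  have "inversion (inversion q) = (inverse ((inverse (norm q))\<^sup>2) * inverse ((norm q)\<^sup>2)) *\<^sub>R q"
    by (subst inversion_def) (simp, simp add: inversion_def)
  also have "inverse ((inverse (norm q))\<^sup>2) * inverse ((norm q)\<^sup>2) = 1"
    using False by (simp add: power_inverse)
  finally show ?thesis by simp
qed simp

lemma has_derivative_inversion:
  assumes "q \<noteq> 0"
  shows "(inversion has_derivative (\<lambda>v. v /\<^sub>R (norm q)\<^sup>2 - (2 * (q \<bullet> v) / (norm q) ^ 4) *\<^sub>R q)) (at q)"
proof -
  have nz: "q \<bullet> q \<noteq> 0" using assms by simp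
  have "((\<lambda>q. inverse (q \<bullet> q) *\<^sub>R q) has_derivative
      (\<lambda>v. inverse (q \<bullet> q) *\<^sub>R v + (- (inverse (q \<bullet> q) * (q \<bullet> v + v \<bullet> q) * inverse (q \<bullet> q))) *\<^sub>R q)) (at q)"
    by (rule derivative_eq_intros nz refl)+
  moreover have "(norm q) ^ 4 = (q \<bullet> q)\<^sup>2" by (simp add: power2_norm_eq_inner[symmetric])
  ultimately show ?thesis
    unfolding inversion_def[abs_def] power2_norm_eq_inner
    by (simp add: inner_commute divide_inverse power2_eq_square algebra_simps)
qed

text \<open>The Gram matrix of the columns is \<open>c\<^sup>2\<close> times the identity, and its
  determinant is the square of \<open>det (matrix D)\<close>.\<close>

lemma conformal_det:
  fixes D :: "real ^ 'n::finite \<Rightarrow> real ^ 'n"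
  assumes D: "\<And>v w. D v \<bullet> D w = c\<^sup>2 * (v \<bullet> w)" and c: "c \<ge> 0"
  shows "\<bar>det (matrix D)\<bar> = c ^ CARD('n)"
proof -
  have "(\<chi> i j. D (axis i 1) \<bullet> D (axis j 1)) = matrix ((*\<^sub>R) (c\<^sup>2))"
    by (simp add: vec_eq_iff D inner_axis_axis) (simp add: matrix_def axis_def)
  then have "(det (matrix D))\<^sup>2 = (c ^ CARD('n))\<^sup>2"
    unfolding det_gram[symmetric] by (simp add: power_mult[symmetric] mult.commute)
  then show ?thesis using c by (metis abs_of_nonneg power2_eq_iff_nonneg abs_ge_zero power2_abs zero_le_power)
qed

text \<open>The derivative of the inversion is \<open>1 / (norm q)\<^sup>2\<close> times the
  reflection in the hyperplane orthogonal to \<open>q\<close>, and reflections preserve inner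
  products.\<close>

lemma inversion_conformal:
  assumes "q \<noteq> 0"
  shows "(v /\<^sub>R (norm q)\<^sup>2 - (2 * (q \<bullet> v) / (norm q) ^ 4) *\<^sub>R q) \<bullet>
      (w /\<^sub>R (norm q)\<^sup>2 - (2 * (q \<bullet> w) / (norm q) ^ 4) *\<^sub>R q) = (1 / (norm q)\<^sup>2)\<^sup>2 * (v \<bullet> w)"
proof -
  have q: "q \<bullet> q = (norm q)\<^sup>2" "norm q \<noteq> 0" using assms by (simp_all add: power2_norm_eq_inner)
  show ?thesis using q(2)
    by (simp add: inner_diff_left inner_diff_right q(1) inner_commute[of v q] inner_commute[of w q]
        field_simps power2_eq_square power4_eq_xxxx)
qed

lemma inversion_borel [measurable]:
  "(inversion :: 'a::euclidean_space \<Rightarrow> 'a) \<in> borel_measurable borel"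
  unfolding inversion_def[abs_def] by measurable

text \<open>The origin needs no exception: the density is \<open>1 / 0 = 0\<close> there.\<close>

lemma lborel_inversion:
  fixes x :: "real ^ 'n::finite"
  shows "distr (density lborel (\<lambda>q. ennreal (1 / norm q ^ (2 * CARD('n))))) borel (\<lambda>q. x + inversion q)
       = lborel" (is "distr (density lborel ?J) borel ?g = _")
proof (rule measure_eqI)
  fix A assume "A \<in> sets (distr (density lborel ?J) borel ?g)"
  then have A [measurable]: "A \<in> sets borel" by simp
  let ?S = "- {0 :: real ^ 'n}"
  have gS: "?g ` ?S = - {x}"
  proof (intro set_eqI iffI)
    fix y assume "y \<in> - {x}"
    then show "y \<in> ?g ` ?S"
      by (intro image_eqI[of _ _ "inversion (y - x)"]) auto
  qed auto
  have inj: "inj_on ?g ?S"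
    by (rule inj_onI) (metis add_left_imp_eq inversion_inversion)
  have "emeasure (distr (density lborel ?J) borel ?g) A
      = (\<integral>\<^sup>+q. ?J q * indicator A (?g q) \<partial>lborel)"
    by (subst nn_integral_indicator[symmetric], simp, subst nn_integral_distr, simp, simp,
        subst nn_integral_density) auto
  also have "\<dots> = (\<integral>\<^sup>+q. ?J q * indicator A (?g q) * indicator ?S q \<partial>lborel)"
    by (rule nn_integral_cong) (simp split: split_indicator)
  also have "\<dots> = (\<integral>\<^sup>+y. indicator A y * indicator (?g ` ?S) y \<partial>lborel)"
  proof (rule nn_integral_change_of_variables[symmetric])
    show "?g ` ?S \<in> sets borel" unfolding gS by simp
    fix q assume "q \<in> ?S"
    then have q: "q \<noteq> 0" by simp
    show "(?g has_derivative (\<lambda>v. v /\<^sub>R (norm q)\<^sup>2 - (2 * (q \<bullet> v) / (norm q) ^ 4) *\<^sub>R q))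
        (at q within ?S)"
      using has_derivative_add[OF has_derivative_const has_derivative_inversion[OF q]]
      by (auto intro: has_derivative_at_withinI)
    show "1 / norm q ^ (2 * CARD('n)) =
        \<bar>det (matrix (\<lambda>v. v /\<^sub>R (norm q)\<^sup>2 - (2 * (q \<bullet> v) / (norm q) ^ 4) *\<^sub>R q))\<bar>"
      by (subst conformal_det[OF inversion_conformal[OF q]])
        (simp_all add: power_mult power_divide power_one_over)
  qed (use inj in simp_all)
  also have "\<dots> = (\<integral>\<^sup>+y. indicator A y \<partial>lborel)"
    unfolding gS
    by (rule nn_integral_cong_AE, rule eventually_mono[OF AE_lborel_singleton[of x]])
      (simp split: split_indicator)
  finally show "emeasure (distr (density lborel ?J) borel ?g) A = emeasure lborel A" by simp
qed simp

lemma integral_inversion: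
  fixes x :: "real ^ 'n::finite" and F :: "real ^ 'n \<Rightarrow> real"
  assumes F [measurable]: "F \<in> borel_measurable borel"
  shows "integrable lborel F \<longleftrightarrow>
      integrable lborel (\<lambda>q. F (x + inversion q) / norm q ^ (2 * CARD('n)))" (is ?int)
    and "(LINT y|lborel. F y) = (LINT q|lborel. F (x + inversion q) / norm q ^ (2 * CARD('n)))" (is ?eq)
proof -
  show ?int
    by (subst lborel_inversion[of x, symmetric])
      (simp add: integrable_distr_eq integrable_real_density mult.commute)
  show ?eq
    by (subst lborel_inversion[of x, symmetric])
      (simp add: integral_distr integral_real_density mult.commute)
qed

text \<open>The bubble is \<open>iota\<close> of the constant 1. Under inversion about a point \<open>x\<close> it turns into a shifted
  bubble with \<open>a = x / (1 + |x|^2)\<close> and \<open>b = phi x / 2\<close>.\<close>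

definition bubble :: "real ^ 'n::finite \<Rightarrow> real" where
  "bubble x = phi x powr (real CARD('n) / 2)"

definition shifted_bubble :: "real ^ 'n::finite \<Rightarrow> real \<Rightarrow> real ^ 'n \<Rightarrow> real" where
  "shifted_bubble a b q = ((norm (q + a))\<^sup>2 + b\<^sup>2) powr (- real CARD('n) / 2)"

lemma bubble_pos [simp]: "bubble x > 0"
  by (simp add: bubble_def)

lemma bubble_measurable [measurable]: "bubble \<in> borel_measurable borel"
  unfolding bubble_def[abs_def] by measurable

text \<open>With \<open>s = 1 + (norm x)\<^sup>2\<close>, expanding
  \<open>(1 + (norm (x + inversion q))\<^sup>2) * (norm q)\<^sup>2\<close> gives
  \<open>s * (q \<bullet> q) + 2 * (q \<bullet> x) + 1\<close>. Completing the square in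
  \<open>q\<close> is the origin of the shift \<open>x /\<^sub>R s\<close> and of the scale
  \<open>1 / s\<close>.\<close>

lemma phi_inversion:
  assumes q: "q \<noteq> 0"
  shows "phi (x + inversion q)
       = phi x * (norm q)\<^sup>2 / ((norm (q + x /\<^sub>R (1 + (norm x)\<^sup>2)))\<^sup>2 + (1 / (1 + (norm x)\<^sup>2))\<^sup>2)"
proof -
  define s where "s = 1 + (norm x)\<^sup>2"
  have s: "s > 0" by (simp add: s_def add_pos_nonneg)
  have x: "x \<bullet> x = s - 1" by (simp add: s_def power2_norm_eq_inner)
  have q2: "q \<bullet> q > 0" using q by simp
  have "(norm (q + x /\<^sub>R s))\<^sup>2 + (1 / s)\<^sup>2 = q \<bullet> q + 2 * (q \<bullet> x) / s + 1 / s"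
    unfolding power2_norm_eq_inner inner_add_left inner_add_right inner_scaleR_left
      inner_scaleR_right x inner_commute[of x q]
    using s by (simp add: field_simps power2_eq_square)
  also have "\<dots> = (1 + (norm (x + inversion q))\<^sup>2) * (q \<bullet> q) / s"
    unfolding power2_norm_eq_inner inner_add_left inner_add_right inversion_def inner_scaleR_left
      inner_scaleR_right x inner_commute[of x q]
    using s q2 by (simp add: field_simps)
  finally have e: "(norm (q + x /\<^sub>R s))\<^sup>2 + (1 / s)\<^sup>2 = (1 + (norm (x + inversion q))\<^sup>2) * (q \<bullet> q) / s" .
  have "1 + (norm (x + inversion q))\<^sup>2 > 0" by (simp add: add_pos_nonneg)
  moreover have "phi x = 2 / s" by (simp add: phi_def s_def)
  ultimately show ?thesis unfolding s_def[symmetric] e using s q2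
    by (simp add: phi_def[of "x + inversion q"] power2_norm_eq_inner)
qed

text \<open>At \<open>y = x + inversion q\<close> the kernel
  \<open>1 / norm (x - y) ^ CARD('n)\<close> becomes \<open>norm q ^ CARD('n)\<close>, and the
  division by \<open>norm q ^ (2 * CARD('n))\<close> is the Jacobian. \<open>phi_inversion\<close>
  to the power N / 2 supplies the remaining \<open>norm q ^ CARD('n)\<close>, so no power of
  \<open>norm q\<close> is left.\<close>

lemma bubble_inversion:
  fixes x q :: "real ^ 'n::finite"
  assumes q: "q \<noteq> 0"
  defines "s \<equiv> 1 + (norm x)\<^sup>2"
  shows "bubble (x + inversion q) * norm q ^ CARD('n) / norm q ^ (2 * CARD('n))
       = bubble x * shifted_bubble (x /\<^sub>R s) (1 / s) q"
proof -
  let ?N = "CARD('n)"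
  let ?k = "(norm (q + x /\<^sub>R s))\<^sup>2 + (1 / s)\<^sup>2"
  have n: "norm q > 0" using q by simp
  note power2_powr_half[OF n, of ?N]
  then have "bubble (x + inversion q) = bubble x * norm q ^ ?N * ?k powr (- real ?N / 2)"
    unfolding bubble_def phi_inversion[OF q] s_def[symmetric]
    by (simp only: divide_powr_half powr_mult)
  then show ?thesis using n by (simp add: shifted_bubble_def power2_eq_square mult_2 power_add)
qed

section \<open>The logarithmic Laplacian of the bubble\<close>

lemma integral_translate:
  fixes f :: "'a::euclidean_space \<Rightarrow> real"
  assumes f [measurable]: "f \<in> borel_measurable borel"
  shows "integrable lborel (\<lambda>q. f (a + q)) \<longleftrightarrow> integrable lborel f"
    and "(LINT q|lborel. f (a + q)) = (LINT q|lborel. f q)"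
proof -
  show "integrable lborel (\<lambda>q. f (a + q)) \<longleftrightarrow> integrable lborel f"
    by (subst (2) lborel_distr_plus[of a, symmetric]) (simp add: integrable_distr_eq)
  show "(LINT q|lborel. f (a + q)) = (LINT q|lborel. f q)"
    by (subst (2) lborel_distr_plus[of a, symmetric]) (simp add: integral_distr)
qed

text \<open>The majorant for Lipschitz difference quotients: one power of the distance is gained
  over the critical kernel, and the radial integrand becomes the constant 1.\<close>

lemma integrable_punctured_power:
  "integrable lborel (\<lambda>y :: real ^ 'n::finite. indicator (ball x 1) y * (norm (x - y) / norm (x - y) ^ CARD('n)))"
proof -
  let ?N = "CARD('n)"
  have N: "?N > 0" by simp
  have [measurable]: "ball x 1 \<in> sets borel" by simp
  have "has_bochner_integral (lborel :: (real ^ 'n) measure)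
      (\<lambda>q. indicator {0..1} (norm q) * (norm q / norm q ^ ?N))
      (real DIM(real ^ 'n) * unit_ball_vol DIM(real ^ 'n) * (1 - 0))"
  proof (rule has_bochner_integral_shell[where h = "\<lambda>_. 1" and H = "\<lambda>r. r"])
    fix r :: real assume "0 < r"
    moreover have "r ^ ?N = r ^ (?N - 1) * r"
      using N by (metis Suc_diff_1 power_Suc2)
    ultimately show "r ^ (DIM(real ^ 'n) - 1) * (r / r ^ ?N) = 1" by simp
  qed auto
  then have "integrable (lborel :: (real ^ 'n) measure)
      (\<lambda>q. indicator {0..1} (norm q) * (norm q / norm q ^ ?N))" by (simp add: has_bochner_integral_iff)
  then have "integrable (lborel :: (real ^ 'n) measure)
      (\<lambda>y. indicator {0..1} (norm (- x + y)) * (norm (- x + y) / norm (- x + y) ^ ?N))"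
    by (subst integral_translate(1)) simp_all
  then show ?thesis
  proof (rule Bochner_Integration.integrable_bound)
    show "AE y in lborel. norm (indicator (ball x 1) y * (norm (x - y) / norm (x - y) ^ ?N))
        \<le> norm (indicator {0..1} (norm (- x + y)) * (norm (- x + y) / norm (- x + y) ^ ?N))"
      by (intro AE_I2) (auto simp: dist_norm norm_minus_commute split: split_indicator)
  qed measurable
qed

text \<open>\<open>Ck_on\<close> gives continuity of the derivative in each fixed direction only.
  The partial derivatives are therefore bounded one by one on the compact ball, and the sum of these
  bounds dominates the operator norm in the mean value inequality.\<close>

lemma Ck_on_1_Lipschitz_on_ball:
  fixes f :: "real ^ 'n::finite \<Rightarrow> real"
  assumes f: "Ck_on 1 UNIV f"
  shows "\<exists>L. \<forall>y\<in>ball x r. \<bar>f x - f y\<bar> \<le> L * norm (x - y)"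
proof -
  let ?D = "\<lambda>y. frechet_derivative f (at y)"
  have der: "(f has_derivative ?D y) (at y)" for y
    using Ck_on_Suc_UNIV_D(1)[of 0 f] f by simp
  have "\<forall>i. \<exists>B. \<forall>y\<in>cball x r. \<bar>?D y (axis i 1)\<bar> \<le> B"
  proof
    fix i
    have "continuous_on (cball x r) (\<lambda>y. ?D y (axis i 1))"
      using f by (auto intro: continuous_on_subset)
    then have "bounded ((\<lambda>y. ?D y (axis i 1)) ` cball x r)"
      by (intro compact_imp_bounded compact_continuous_image compact_cball)
    then show "\<exists>B. \<forall>y\<in>cball x r. \<bar>?D y (axis i 1)\<bar> \<le> B" by (auto simp: bounded_iff)
  qed
  then obtain B where B: "\<And>i y. y \<in> cball x r \<Longrightarrow> \<bar>?D y (axis i 1)\<bar> \<le> B i" by metis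
  have "norm (f y - f x) \<le> (\<Sum>i\<in>UNIV. B i) * norm (y - x)" if "y \<in> cball x r" for y
  proof (rule differentiable_bound[of "cball x r" f ?D])
    show "(f has_derivative ?D z) (at z within cball x r)" for z
      using der by (rule has_derivative_at_withinI)
    fix z assume z: "z \<in> cball x r"
    have lin: "linear (?D z)" using der by (rule has_derivative_linear)
    show "onorm (?D z) \<le> (\<Sum>i\<in>UNIV. B i)"
    proof (rule onorm_le)
      fix v
      have "?D z v = ?D z (\<Sum>i\<in>UNIV. v $ i *\<^sub>R axis i 1)"
        by (simp add: basis_expansion[of v, unfolded scalar_mult_eq_scaleR])
      also have "\<dots> = (\<Sum>i\<in>UNIV. v $ i * ?D z (axis i 1))"
        by (simp add: linear_sum[OF lin] linear_scale[OF lin])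
      finally have "norm (?D z v) \<le> (\<Sum>i\<in>UNIV. norm (v $ i * ?D z (axis i 1)))"
        by (simp only: norm_sum)
      also have "\<dots> \<le> (\<Sum>i\<in>UNIV. norm v * B i)"
        unfolding real_norm_def abs_mult
        by (intro sum_mono mult_mono component_le_norm_cart B z) auto
      finally show "norm (?D z v) \<le> (\<Sum>i\<in>UNIV. B i) * norm v"
        by (simp add: sum_distrib_left mult.commute)
    qed
  qed (use that in \<open>auto intro: order_trans[OF zero_le_dist]\<close>)
  then show ?thesis
    by (intro exI[of _ "\<Sum>i\<in>UNIV. B i"]) (auto simp: abs_minus_commute norm_minus_commute)
qed

lemma set_integrable_difference_quotient:
  fixes f :: "real ^ 'n::finite \<Rightarrow> real"
  assumes f: "Ck_on 1 UNIV f"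
  shows "set_integrable lborel (ball x 1) (\<lambda>y. (f x - f y) / norm (x - y) ^ CARD('n))"
proof -
  obtain L where L: "\<And>y. y \<in> ball x 1 \<Longrightarrow> \<bar>f x - f y\<bar> \<le> L * norm (x - y)"
    using Ck_on_1_Lipschitz_on_ball[OF f] by blast
  have "Ck_on 0 UNIV f" using Ck_on_Suc_imp_Ck_on[of 0 UNIV f] f by simp
  then have [measurable]: "f \<in> borel_measurable borel"
    by (simp add: borel_measurable_continuous_onI)
  have [measurable]: "ball x 1 \<in> sets borel" by simp
  show ?thesis unfolding set_integrable_def
  proof (rule Bochner_Integration.integrable_bound)
    show "integrable lborel (\<lambda>y. L * (indicator (ball x 1) y * (norm (x - y) / norm (x - y) ^ CARD('n))))"
      by (intro integrable_mult_right integrable_punctured_power)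
    show "AE y in lborel. norm (indicator (ball x 1) y *\<^sub>R ((f x - f y) / norm (x - y) ^ CARD('n)))
        \<le> norm (L * (indicator (ball x 1) y * (norm (x - y) / norm (x - y) ^ CARD('n))))"
    proof (intro AE_I2)
      fix y
      show "norm (indicator (ball x 1) y *\<^sub>R ((f x - f y) / norm (x - y) ^ CARD('n)))
        \<le> norm (L * (indicator (ball x 1) y * (norm (x - y) / norm (x - y) ^ CARD('n))))"
        using L[of y] abs_ge_self[of "L * norm (x - y)"]
        by (auto simp: abs_mult intro!: divide_right_mono split: split_indicator)
    qed
  qed measurable
qed

lemma shifted_bubble_continuous: "b > 0 \<Longrightarrow> continuous_on S (shifted_bubble a b)"
  unfolding shifted_bubble_def[abs_def]
  by (intro continuous_intros) (auto simp: add_nonneg_eq_0_iff)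

lemma shifted_bubble_measurable: "b > 0 \<Longrightarrow> shifted_bubble a b \<in> borel_measurable borel"
  by (intro borel_measurable_continuous_onI shifted_bubble_continuous)

lemma shifted_bubble_integrable:
  "b > 0 \<Longrightarrow> integrable lborel (\<lambda>q. indicator (cball z R) q * shifted_bubble a b q)"
  using borel_integrable_compact[OF compact_cball shifted_bubble_continuous, of b z R a] by simp

text \<open>Scaling by \<open>b\<close> reduces to the primitive \<open>H\<close> for
  \<open>b = 1\<close>; the integrand has the homogeneity of \<open>dr / r\<close>, so no power of
  \<open>b\<close> remains in front.\<close>

lemma integral_bubble_ball:
  fixes H :: "real \<Rightarrow> real"
  assumes b: "b > 0" and R: "R \<ge> 0" and H0: "H 0 = 0"
    and H: "\<And>r. (H has_real_derivative r ^ (CARD('n::finite) - 1) * (1 + r\<^sup>2) powr (- real CARD('n) / 2)) (at r)"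
  shows "(LINT q|lborel. indicator (cball 0 R) q * shifted_bubble 0 b (q :: real ^ 'n))
    = real CARD('n) * unit_ball_vol CARD('n) * H (R / b)"
proof -
  let ?N = "CARD('n)"
  have N: "?N > 0" by simp
  let ?k = "\<lambda>r::real. (r\<^sup>2 + b\<^sup>2) powr (- real ?N / 2)"
  have pos: "r\<^sup>2 + b\<^sup>2 > 0" for r using b by (intro add_nonneg_pos) simp_all
  have m: "?k \<in> borel_measurable borel"
    using pos by (intro borel_measurable_continuous_onI continuous_on_powr continuous_intros)
      (metis less_numeral_extra(3))
  have "has_bochner_integral (lborel :: (real ^ 'n) measure)
      (\<lambda>q. indicator {0..R} (norm q) * ?k (norm q))
      (real DIM(real ^ 'n) * unit_ball_vol DIM(real ^ 'n) * (H (R / b) - H (0 / b)))"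
  proof (rule has_bochner_integral_shell[where h = "\<lambda>r. r ^ (?N - 1) * ?k r" and H = "\<lambda>r. H (r / b)"])
    fix r :: real
    have "((\<lambda>r. H (r / b)) has_real_derivative
        ((r / b) ^ (?N - 1) * (1 + (r / b)\<^sup>2) powr (- real ?N / 2)) * (1 / b)) (at r)"
      by (rule DERIV_chain2[OF H]) (use b in \<open>auto intro!: derivative_eq_intros\<close>)
    moreover have "((r / b) ^ (?N - 1) * (1 + (r / b)\<^sup>2) powr (- real ?N / 2)) * (1 / b)
        = r ^ (?N - 1) * ?k r"
    proof -
      have "r\<^sup>2 + b\<^sup>2 = b\<^sup>2 * (1 + (r / b)\<^sup>2)" using b by (simp add: field_simps)
      then have "?k r = (b\<^sup>2) powr (- real ?N / 2) * (1 + (r / b)\<^sup>2) powr (- real ?N / 2)"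
        by (simp only: powr_mult)
      moreover have "(b\<^sup>2) powr (- real ?N / 2) = 1 / b ^ ?N"
        using powr_minus_divide[of "b\<^sup>2" "real ?N / 2"] power2_powr_half[OF b, of ?N] by simp
      moreover have "b ^ ?N = b ^ (?N - 1) * b" using N by (metis Suc_diff_1 power_Suc2)
      ultimately show ?thesis by (simp add: power_divide)
    qed
    ultimately show "((\<lambda>r. H (r / b)) has_real_derivative r ^ (?N - 1) * ?k r) (at r)" by simp
  qed (use R m in auto)
  then have "(LINT q|lborel. indicator {0..R} (norm q) * ?k (norm (q :: real ^ 'n)))
      = real ?N * unit_ball_vol ?N * H (R / b)"
    using H0 by (simp add: has_bochner_integral_iff)
  moreover have "indicator {0..R} (norm q) * ?k (norm q) = indicator (cball 0 R) q * shifted_bubble 0 b q"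
    for q :: "real ^ 'n"
    by (simp add: shifted_bubble_def split: split_indicator)
  ultimately show ?thesis by simp
qed

text \<open>The shift does not affect the limit: a ball of radius \<open>n\<close> about \<open>a\<close> lies between the centred balls of
  radii \<open>n - norm a\<close> and \<open>n + norm a\<close>, whose integrals differ by \<open>o(1)\<close>.\<close>

lemma shifted_bubble_ball_asymptotics:
  fixes a :: "real ^ 'n::finite"
  assumes b: "b > 0"
  shows "(\<lambda>n. (LINT q|lborel. indicator (cball 0 (real n)) q * shifted_bubble a b q)
      - real CARD('n) * unit_ball_vol CARD('n) * ln (real n))
    \<longlonglongrightarrow> real CARD('n) * unit_ball_vol CARD('n) *
        (- (Digamma (real CARD('n) / 2) + euler_mascheroni) / 2 - ln b)"
proof -
  define w where "w = real CARD('n) * unit_ball_vol (real CARD('n))"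
  define \<kappa> where "\<kappa> = - (Digamma (real CARD('n) / 2) + euler_mascheroni) / 2"
  have w: "w \<ge> 0" by (simp add: w_def)
  obtain H :: "real \<Rightarrow> real" where H: "H 0 = 0"
    "\<And>r. (H has_real_derivative r ^ (CARD('n) - 1) * (1 + r\<^sup>2) powr (- real CARD('n) / 2)) (at r)"
    "((\<lambda>R. H R - ln R) \<longlongrightarrow> \<kappa>) at_top"
    using ex_radial_primitive[of "CARD('n)"] unfolding \<kappa>_def by auto
  let ?I = "\<lambda>n. LINT q|lborel. indicator (cball 0 (real n)) q * shifted_bubble a b q"
  \<comment> \<open>Used with \<open>s = - norm a\<close> and \<open>s = norm a\<close>: any fixed
    offset disappears in the logarithm, so the lower and the upper bound share their limit.\<close>
  have lim: "(\<lambda>n. w * H ((real n + s) / b) - w * ln (real n)) \<longlonglongrightarrow> w * (\<kappa> - ln b)" for s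
  proof -
    have "filterlim (\<lambda>n. (real n + s) / b) at_top sequentially" using b by real_asymp
    note 1 = filterlim_compose[OF H(3) this]
    have "(\<lambda>n. ln ((real n + s) / b) - ln (real n)) \<longlonglongrightarrow> ln (inverse b)"
      using b by real_asymp
    then have "(\<lambda>n. ln ((real n + s) / b) - ln (real n)) \<longlonglongrightarrow> - ln b"
      by (simp add: ln_inverse)
    with 1 have "(\<lambda>n. w * ((H ((real n + s) / b) - ln ((real n + s) / b)) +
        (ln ((real n + s) / b) - ln (real n)))) \<longlonglongrightarrow> w * (\<kappa> + - ln b)"
      by (intro tendsto_intros)
    then show ?thesis by (simp add: algebra_simps)
  qed
  have transl: "shifted_bubble a b q = shifted_bubble 0 b (a + q)" for q
    by (simp add: shifted_bubble_def add.commute)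
  have m: "(\<lambda>q :: real ^ 'n. indicator (cball 0 R) q * shifted_bubble 0 b q) \<in> borel_measurable borel" for R
    by (rule borel_measurable_times[OF borel_measurable_indicator shifted_bubble_measurable[OF b]]) simp
  have shift: "(LINT q|lborel. indicator (cball 0 R) (a + q) * shifted_bubble a b q) = w * H (R / b)"
    if "R \<ge> 0" for R
    unfolding transl
    by (subst integral_translate(2)[OF m]) (simp add: integral_bubble_ball[OF b that H(1,2)] w_def)
  have int: "integrable lborel (\<lambda>q. indicator (cball 0 R) (a + q) * shifted_bubble a b q)" for R
    unfolding transl by (subst integral_translate(1)[OF m]) (rule shifted_bubble_integrable[OF b])
  have nn: "shifted_bubble a b q \<ge> 0" for q by (simp add: shifted_bubble_def)
  have "w * H ((real n + - norm a) / b) \<le> ?I n" if "real n \<ge> norm a" for n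
  proof -
    have "norm q \<le> real n" if "norm (a + q) \<le> real n - norm a" for q
      using norm_triangle_ineq4[of "a + q" a] that by simp
    then have "(LINT q|lborel. indicator (cball 0 (real n - norm a)) (a + q) * shifted_bubble a b q) \<le> ?I n"
      by (intro integral_mono int shifted_bubble_integrable b) (auto simp: nn split: split_indicator)
    then show ?thesis using that by (simp add: shift)
  qed
  moreover have "?I n \<le> w * H ((real n + norm a) / b)" for n
  proof -
    have "norm (a + q) \<le> real n + norm a" if "norm q \<le> real n" for q
      using norm_triangle_ineq[of a q] that by simp
    then have "?I n \<le> (LINT q|lborel. indicator (cball 0 (real n + norm a)) (a + q) * shifted_bubble a b q)"
      by (intro integral_mono int shifted_bubble_integrable b) (auto simp: nn split: split_indicator)
    then show ?thesis by (simp add: shift)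
  qed
  ultimately have "(\<lambda>n. ?I n - w * ln (real n)) \<longlonglongrightarrow> w * (\<kappa> - ln b)"
    using eventually_ge_at_top[of "nat \<lceil>norm a\<rceil>"]
    by (intro tendsto_sandwich[OF _ _ lim[of "- norm a"] lim[of "norm a"]])
      (auto elim!: eventually_mono simp: nat_ceiling_le_eq)
  then show ?thesis by (simp add: w_def \<kappa>_def)
qed

text \<open>Inversion about \<open>x\<close> carries the exterior region to the punctured closed
  unit ball, where the transformed integrand is a continuous function. Compactness thus replaces a
  decay estimate.\<close>

lemma set_integrable_bubble_tail:
  "set_integrable lborel (- ball x 1) (\<lambda>y. bubble y / norm (x - y) ^ CARD('n::finite))"
  for x :: "real ^ 'n"
proof -
  let ?N = "CARD('n)"
  define s where "s = 1 + (norm x)\<^sup>2"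
  have s: "1 / s > 0" by (simp add: s_def add_pos_nonneg)
  let ?F = "\<lambda>y. indicator (- ball x 1) y * (bubble y / norm (x - y) ^ ?N)"
  let ?G = "\<lambda>q. bubble x * (indicator (cball 0 1) q * shifted_bubble (x /\<^sub>R s) (1 / s) q)"
  have [measurable]: "ball x 1 \<in> sets borel" "cball 0 1 \<in> sets borel"
    "shifted_bubble (x /\<^sub>R s) (1 / s) \<in> borel_measurable borel"
    using shifted_bubble_measurable[OF s] by simp_all
  have F: "?F \<in> borel_measurable borel" by measurable
  have "?F (x + inversion q) / norm q ^ (2 * ?N) = ?G q" if "q \<noteq> 0" for q
  proof -
    have "dist x (x + inversion q) < 1 \<longleftrightarrow> norm q > 1"
      using that by (simp add: dist_norm inverse_less_1_iff)
    then show ?thesis using bubble_inversion[OF that, of x, folded s_def]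
      by (simp add: divide_inverse power_inverse split: split_indicator)
  qed
  then have "AE q in lborel. ?F (x + inversion q) / norm q ^ (2 * ?N) = ?G q"
    by (intro eventually_mono[OF AE_lborel_singleton[of 0]])
  moreover have "integrable lborel ?G"
    by (intro integrable_mult_right shifted_bubble_integrable s)
  ultimately have "integrable lborel (\<lambda>q. ?F (x + inversion q) / norm q ^ (2 * ?N))"
    by (subst integrable_cong_AE[where g = ?G]) (use F in measurable)
  then show ?thesis
    using integral_inversion(1)[OF F, of x] by (simp add: set_integrable_def)
qed

lemma Ck_on_1_bubble: "Ck_on 1 UNIV (bubble :: real ^ 'n::finite \<Rightarrow> real)"
proof -
  let ?p = "real CARD('n) / 2"
  have "Ck_on (Suc 0) UNIV (bubble :: real ^ 'n \<Rightarrow> real)"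
  proof (rule Ck_on_Suc_UNIV_I)
    have "((\<lambda>t. t powr ?p) has_derivative (*) (?p * phi x powr (?p - 1))) (at (phi x))"
      for x :: "real ^ 'n"
      using has_real_derivative_powr[OF phi_pos, of ?p x] by (simp add: has_field_derivative_def)
    from diff_chain_at[OF has_derivative_phi this]
    show "(bubble has_derivative (\<lambda>v. ?p * phi x powr (?p - 1) * (- (phi x)\<^sup>2 * (x \<bullet> v)))) (at x)"
      for x :: "real ^ 'n"
      by (simp add: bubble_def[abs_def] o_def)
    show "Ck_on 0 UNIV (\<lambda>x :: real ^ 'n. ?p * phi x powr (?p - 1) * (- (phi x)\<^sup>2 * (x \<bullet> v)))" for v
      by (auto intro!: continuous_intros)
  qed
  then show ?thesis by simp
qed

lemma set_integral_split:
  fixes f g h :: "'a::euclidean_space \<Rightarrow> real"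
  assumes g: "set_integrable lborel A g" and h: "set_integrable lborel (- A) h"
    and f: "\<And>y. y \<in> A \<Longrightarrow> f y = g y" "\<And>y. y \<notin> A \<Longrightarrow> f y = h y"
  shows "integrable lborel f" "(LINT y|lborel. f y) = (LINT y:A|lborel. g y) + (LINT y:-A|lborel. h y)"
proof -
  have eq: "f = (\<lambda>y. indicator A y *\<^sub>R g y + indicator (- A) y *\<^sub>R h y)"
    using f by (auto split: split_indicator)
  show "integrable lborel f"
    using g h unfolding eq set_integrable_def by (rule Bochner_Integration.integrable_add)
  show "(LINT y|lborel. f y) = (LINT y:A|lborel. g y) + (LINT y:-A|lborel. h y)"
    using g h unfolding eq set_integrable_def set_lebesgue_integral_def
    by (rule Bochner_Integration.integral_add)
qed

lemma integral_ln_shell: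
  assumes "n \<ge> (1::real)"
  shows "integrable lborel (\<lambda>q :: real ^ 'n::finite. indicator {1<..n} (norm q) / norm q ^ CARD('n))"
    and "(LINT q|lborel. indicator {1<..n} (norm (q :: real ^ 'n)) / norm q ^ CARD('n))
      = real CARD('n) * unit_ball_vol CARD('n) * ln n"
proof -
  let ?N = "CARD('n)"
  have N: "?N > 0" by simp
  \<comment> \<open>The strict indicator matches the complement of the closed unit ball; it spoils
    the radial integrand only at the inner radius 1, which the shell formula tolerates.\<close>
  have "has_bochner_integral (lborel :: (real ^ 'n) measure)
      (\<lambda>q. indicator {1..n} (norm q) * (indicator {1<..} (norm q) / norm q ^ ?N))
      (real DIM(real ^ 'n) * unit_ball_vol DIM(real ^ 'n) * (ln n - ln 1))"
  proof (rule has_bochner_integral_shell[where h = "\<lambda>r. 1 / r" and H = ln])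
    fix r :: real assume "1 < r"
    moreover have "r ^ ?N = r ^ (?N - 1) * r"
      using N by (metis Suc_diff_1 power_Suc2)
    ultimately show "r ^ (DIM(real ^ 'n) - 1) * (indicator {1<..} r / r ^ ?N) = 1 / r" by simp
  qed (use assms in \<open>auto intro!: DERIV_ln_divide\<close>)
  moreover have "(\<lambda>q :: real ^ 'n. indicator {1..n} (norm q) * (indicator {1<..} (norm q) / norm q ^ ?N))
      = (\<lambda>q. indicator {1<..n} (norm q) / norm q ^ ?N :: real)"
    by (auto split: split_indicator)
  ultimately show "integrable lborel (\<lambda>q :: real ^ 'n. indicator {1<..n} (norm q) / norm q ^ ?N)"
    "(LINT q|lborel. indicator {1<..n} (norm (q :: real ^ 'n)) / norm q ^ ?N)
      = real ?N * unit_ball_vol ?N * ln n"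
    by (simp_all add: has_bochner_integral_iff)
qed

text \<open>Both terms of \<open>\<Phi>\<close> behave like \<open>norm q\<close> to the power -N at
  infinity, so only their difference can be integrable. Dominated convergence exhausts the space by
  balls of radius \<open>n\<close>; on each ball the terms separate, and the second contributes
  exactly the \<open>ln n\<close> that the asymptotics of the first subtracts.\<close>

lemma integral_regularized_bubble:
  fixes a :: "real ^ 'n::finite"
  assumes b: "b > 0"
  defines "\<Phi> \<equiv> \<lambda>q. shifted_bubble a b q - indicator (- cball 0 1) q / norm q ^ CARD('n)"
  assumes int: "integrable lborel \<Phi>"
  shows "(LINT q|lborel. \<Phi> q) = real CARD('n) * unit_ball_vol CARD('n) *
      (- (Digamma (real CARD('n) / 2) + euler_mascheroni) / 2 - ln b)"
proof -
  let ?N = "CARD('n)" and ?B = "\<lambda>n. cball (0 :: real ^ 'n) (real n)"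
  have [measurable]: "?B n \<in> sets borel" for n by simp
  have [measurable]: "\<Phi> \<in> borel_measurable lborel" using int by (rule borel_measurable_integrable)
  have "(\<lambda>n. LINT q|lborel. indicator (?B n) q * \<Phi> q) \<longlonglongrightarrow> (LINT q|lborel. \<Phi> q)"
  proof (rule integral_dominated_convergence[where w = "\<lambda>q. norm (\<Phi> q)"])
    show "integrable lborel (\<lambda>q. norm (\<Phi> q))" using int by (rule integrable_norm)
    show "AE q in lborel. (\<lambda>n. indicator (?B n) q * \<Phi> q) \<longlonglongrightarrow> \<Phi> q"
    proof (intro AE_I2)
      fix q :: "real ^ 'n"
      have "eventually (\<lambda>n. norm q \<le> real n) sequentially"
        using eventually_ge_at_top[of "nat \<lceil>norm q\<rceil>"] by eventually_elim linarith
      then have "eventually (\<lambda>n. indicator (?B n) q * \<Phi> q = \<Phi> q) sequentially"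
        by eventually_elim simp
      then show "(\<lambda>n. indicator (?B n) q * \<Phi> q) \<longlonglongrightarrow> \<Phi> q" by (rule tendsto_eventually)
    qed
  qed (auto split: split_indicator)
  moreover have "eventually (\<lambda>n. (LINT q|lborel. indicator (?B n) q * \<Phi> q) =
      (LINT q|lborel. indicator (?B n) q * shifted_bubble a b q)
        - real ?N * unit_ball_vol ?N * ln (real n)) sequentially"
    using eventually_ge_at_top[of 1]
  proof eventually_elim
    case (elim n)
    have "indicator (?B n) q * \<Phi> q = indicator (?B n) q * shifted_bubble a b q
        - indicator {1<..real n} (norm q) / norm q ^ ?N" for q
      by (simp add: \<Phi>_def algebra_simps split: split_indicator)
    then show ?case
      using elim by (simp add: integral_ln_shell shifted_bubble_integrable[OF b])
  qed
  ultimately show ?thesis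
    by (intro LIMSEQ_unique[OF _ shifted_bubble_ball_asymptotics[OF b, of a]])
      (rule Lim_transform_eventually)
qed

lemma log_Laplacian_bubble:
  fixes x :: "real ^ 'n::finite"
  shows "log_Laplacian bubble x = bubble x * (A_const CARD('n) + 2 * ln (phi x))"
proof -
  let ?N = "CARD('n)"
  define s where "s = 1 + (norm x)\<^sup>2"
  have s: "1 / s > 0" by (simp add: s_def add_pos_nonneg)
  have phi: "phi x = 2 * (1 / s)" by (simp add: phi_def s_def)
  \<comment> \<open>Both integrals of \<open>log_Laplacian\<close> in one integrand, with reversed
    sign, so that a single inversion transforms them together.\<close>
  define F where "F y = (bubble y - indicator (ball x 1) y * bubble x) / norm (x - y) ^ ?N" for y
  define \<Phi> where "\<Phi> = (\<lambda>q. shifted_bubble (x /\<^sub>R s) (1 / s) q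
      - indicator (- cball 0 1) q / norm q ^ ?N)"
  have [measurable]: "ball x 1 \<in> sets borel" "cball (0 :: real ^ 'n) 1 \<in> sets borel"
    "shifted_bubble (x /\<^sub>R s) (1 / s) \<in> borel_measurable borel"
    using shifted_bubble_measurable[OF s] by simp_all
  have F_meas: "F \<in> borel_measurable borel" unfolding F_def[abs_def] by measurable
  have \<Phi>_meas [measurable]: "\<Phi> \<in> borel_measurable borel" unfolding \<Phi>_def by measurable
  let ?A1 = "LINT y:ball x 1|lborel. (bubble x - bubble y) / norm (x - y) ^ ?N"
  let ?A2 = "LINT y:- ball x 1|lborel. bubble y / norm (x - y) ^ ?N"
  have i1: "set_integrable lborel (ball x 1) (\<lambda>y. - ((bubble x - bubble y) / norm (x - y) ^ ?N))"
    using set_integrable_difference_quotient[OF Ck_on_1_bubble, of x]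
    by (simp add: set_integrable_def)
  have F_int: "integrable lborel F"
    by (rule set_integral_split(1)[OF i1 set_integrable_bubble_tail])
      (simp_all add: F_def minus_divide_left)
  have "(LINT y|lborel. F y) = (LINT y:ball x 1|lborel. - ((bubble x - bubble y) / norm (x - y) ^ ?N)) + ?A2"
    by (rule set_integral_split(2)[OF i1 set_integrable_bubble_tail])
      (simp_all add: F_def minus_divide_left)
  also have "(LINT y:ball x 1|lborel. - ((bubble x - bubble y) / norm (x - y) ^ ?N)) = - ?A1"
    by (simp add: set_lebesgue_integral_def)
  finally have F_val: "(LINT y|lborel. F y) = - ?A1 + ?A2" .
  have "F (x + inversion q) / norm q ^ (2 * ?N) = bubble x * \<Phi> q" if q: "q \<noteq> 0" for q
  proof -
    have "dist x (x + inversion q) < 1 \<longleftrightarrow> \<not> norm q \<le> 1"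
      using q by (simp add: dist_norm inverse_less_1_iff not_le)
    then have ind: "indicator (ball x 1) (x + inversion q) = (indicator (- cball 0 1) q :: real)"
      by (simp split: split_indicator)
    have "F (x + inversion q) / norm q ^ (2 * ?N)
        = bubble (x + inversion q) * norm q ^ ?N / norm q ^ (2 * ?N)
        - indicator (- cball 0 1) q * bubble x * (norm q ^ ?N / norm q ^ (2 * ?N))"
      by (simp add: F_def ind divide_inverse power_inverse algebra_simps)
    also have "norm q ^ ?N / norm q ^ (2 * ?N) = 1 / norm q ^ ?N"
      using q by (simp add: mult_2 power_add)
    finally show ?thesis
      using bubble_inversion[OF q, of x, folded s_def] by (simp add: \<Phi>_def algebra_simps)
  qed
  then have ae: "AE q in lborel. F (x + inversion q) / norm q ^ (2 * ?N) = bubble x * \<Phi> q"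
    by (intro eventually_mono[OF AE_lborel_singleton[of 0]])
  have m: "(\<lambda>q. F (x + inversion q) / norm q ^ (2 * ?N)) \<in> borel_measurable lborel"
    using F_meas by measurable
  \<comment> \<open>Integrability of \<open>\<Phi>\<close> is inherited from \<open>F\<close>: the
    difference quotient near \<open>x\<close> accounts for infinity, the bubble tail for the closed
    unit ball.\<close>
  have "integrable lborel (\<lambda>q. bubble x * \<Phi> q)"
    using F_int integral_inversion(1)[OF F_meas, of x] integrable_cong_AE[OF m _ ae] by simp
  then have \<Phi>_int: "integrable lborel \<Phi>"
    using bubble_pos[of x] by (simp add: less_imp_neq[symmetric] del: bubble_pos)
  have "- ?A1 + ?A2 = (LINT q|lborel. bubble x * \<Phi> q)"
    unfolding F_val[symmetric] integral_inversion(2)[OF F_meas, of x]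
    by (rule integral_cong_AE[OF m _ ae]) simp
  also have "\<dots> = bubble x * (real ?N * unit_ball_vol ?N *
      (- (Digamma (real ?N / 2) + euler_mascheroni) / 2 - ln (1 / s)))"
    using integral_regularized_bubble[OF s, of "x /\<^sub>R s"] \<Phi>_int by (simp add: \<Phi>_def)
  finally have val: "- ?A1 + ?A2 = \<dots>" .
  have "c_const ?N * ?A1 - c_const ?N * ?A2 = - c_const ?N * (- ?A1 + ?A2)"
    by (simp add: algebra_simps)
  also have "\<dots> = - (c_const ?N * (real ?N * unit_ball_vol ?N)) * bubble x *
        (- (Digamma (real ?N / 2) + euler_mascheroni) / 2 - ln (1 / s))"
    unfolding val by (simp only: mult_ac mult_minus_left mult_minus_right)
  also have "\<dots> = bubble x * (Digamma (real ?N / 2) + euler_mascheroni + 2 * ln (1 / s))"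
    by (simp add: c_const_sphere_area field_simps)
  \<comment> \<open>Adding \<open>rho_const\<close> cancels \<open>euler_mascheroni\<close> and
    doubles \<open>Digamma\<close>; its \<open>2 * ln 2\<close> joins \<open>2 * ln (1 / s)\<close>
    to form \<open>2 * ln (phi x)\<close>.\<close>
  finally show ?thesis
    using ln_mult_pos[OF _ s, of 2, folded phi]
    unfolding log_Laplacian_def by (simp add: A_const_def rho_const_def algebra_simps)
qed

section \<open>The conjugation formula\<close>

text \<open>Inversion in the unit sphere of R^N corresponds to reflection in the equator. Points
  outside the unit ball are thereby moved to bounded coordinates in the reflected chart.\<close>

lemma stereo_inv_inversion:
  fixes y :: "real ^ 'n::finite"
  assumes "y \<noteq> 0"
  shows "reflect (stereo_inv (inversion y)) = stereo_inv y"
proof -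
  define t where "t = (norm y)\<^sup>2"
  have t: "t > 0" using assms by (simp add: t_def)
  have p: "phi y = 2 / (1 + t)" "phi (inversion y) = 2 * t / (1 + t)"
    using t by (simp_all add: phi_def t_def[symmetric] power_inverse field_simps)
  have "phi (inversion y) *\<^sub>R inversion y = phi y *\<^sub>R y"
    unfolding p unfolding inversion_def t_def[symmetric] using t by simp
  moreover have "- phi (inversion y) + 1 = phi y - 1"
    using t by (simp add: p field_simps)
  ultimately show ?thesis by (simp add: stereo_inv_alt reflect_def)
qed

lemma smooth_on_sphere_compose:
  assumes "smooth_on_sphere u" "sphere_param UNIV f"
  shows "Ck_on k UNIV (\<lambda>x. u (f x))"
  using assms by (auto simp: smooth_on_sphere_def Cinf_on_def o_def)

text \<open>Smoothness is given only through charts, so compactness is used there: the closed unit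
  balls of the two stereographic charts cover the two closed hemispheres.\<close>

lemma smooth_on_sphere_bounded:
  fixes u :: "'n::finite amb \<Rightarrow> real"
  assumes u: "smooth_on_sphere u"
  shows "\<exists>C. \<forall>y. \<bar>u (stereo_inv y)\<bar> \<le> C"
proof -
  have ex: "\<exists>C. \<forall>y\<in>cball 0 1. \<bar>u (f y)\<bar> \<le> C" if "sphere_param UNIV f" for f :: "real ^ 'n \<Rightarrow> 'n amb"
  proof -
    have "continuous_on UNIV (\<lambda>x. u (f x))" using smooth_on_sphere_compose[OF u that, of 0] by simp
    then have "bounded ((\<lambda>x. u (f x)) ` cball 0 1)"
      by (intro compact_imp_bounded compact_continuous_image compact_cball) (rule continuous_on_subset, auto)
    then show ?thesis by (auto simp: bounded_iff)
  qed
  obtain C where C: "\<forall>y\<in>cball 0 1. \<bar>u (stereo_inv y)\<bar> \<le> C"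
    using ex[OF sphere_param_stereo_inv] by blast
  obtain C' where C': "\<forall>y\<in>cball 0 1. \<bar>u (reflect (stereo_inv y))\<bar> \<le> C'"
    using ex[OF sphere_param_reflect] by blast
  have "\<bar>u (stereo_inv y)\<bar> \<le> max C C'" for y
  proof (cases "norm y \<le> 1")
    case False
    then have "y \<noteq> 0" "norm (inversion y) \<le> 1" by (auto simp: inverse_le_1_iff)
    then show ?thesis using bspec[OF C', of "inversion y"] by (simp add: stereo_inv_inversion)
  qed (use C in \<open>simp add: le_max_iff_disj\<close>)
  then show ?thesis by blast
qed

text \<open>Off the south pole \<open>u\<close> is the continuous function
  \<open>u o stereo_inv\<close> composed with the Borel map \<open>stereo\<close>; the pole is a
  single exceptional point.\<close>

lemma smooth_on_sphere_measurable:
  fixes u :: "'n::finite amb \<Rightarrow> real"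
  assumes u: "smooth_on_sphere u"
  shows "u \<in> borel_measurable (restrict_space borel (sphere 0 1))"
proof -
  have [measurable]: "(\<lambda>x. u (stereo_inv x)) \<in> borel_measurable borel"
    using smooth_on_sphere_compose[OF u sphere_param_stereo_inv, of 0]
    by (simp add: borel_measurable_continuous_onI)
  have [measurable]: "(stereo :: 'n amb \<Rightarrow> _) \<in> borel_measurable borel"
    unfolding stereo_def[abs_def]
    by (intro borel_measurable_scaleR borel_measurable_inverse borel_measurable_add
        borel_measurable_const borel_measurable_continuous_onI continuous_intros)
  have "(\<lambda>z. if z = (0, - 1) then u (0, - 1) else u (stereo_inv (stereo z)))
      \<in> borel_measurable (restrict_space borel (sphere 0 1))"
    by (intro measurable_restrict_space1) measurable
  then show ?thesis
    by (rule measurable_cong[THEN iffD1, rotated])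
      (auto simp: space_restrict_space stereo_inv_stereo simp del: split_paired_All)
qed

lemma iota_eq: "iota u = (\<lambda>y. bubble y * u (stereo_inv y))"
  by (simp add: fun_eq_iff iota_def bubble_def)

text \<open>The chordal kernel contributes \<open>1 / (bubble x * bubble y)\<close> and the volume
  contributes \<open>(bubble y)\<^sup>2\<close>. The prefactor \<open>bubble x\<close> cancels, and
  one factor \<open>bubble y\<close> remains to turn \<open>u\<close> into
  \<open>iota u\<close>.\<close>

lemma Plog_stereo_inv:
  fixes u :: "'n::finite amb \<Rightarrow> real"
  assumes u: "smooth_on_sphere u"
  shows "bubble x * Plog u (stereo_inv x) =
      c_const CARD('n) * (LINT y|lborel. (bubble y * u (stereo_inv x) - iota u y) / norm (x - y) ^ CARD('n))
      + A_const CARD('n) * iota u x"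
proof -
  let ?N = "CARD('n)" and ?U = "\<lambda>y. u (stereo_inv y)"
  let ?f = "\<lambda>\<zeta>. (u (stereo_inv x) - u \<zeta>) / norm (stereo_inv x - \<zeta>) ^ ?N"
  have f: "?f \<in> borel_measurable (restrict_space borel (sphere 0 1))"
    by (intro borel_measurable_divide borel_measurable_diff borel_measurable_const
        smooth_on_sphere_measurable u borel_measurable_power measurable_restrict_space1) measurable
  have half: "bubble y * bubble y = phi y ^ ?N" for y :: "real ^ 'n"
    by (simp add: bubble_def powr_add[symmetric] powr_realpow)
  have root: "sqrt (phi x * phi y) ^ ?N = bubble x * bubble y" for y :: "real ^ 'n"
    using power2_powr_half[of "sqrt (phi x * phi y)" ?N]
    by (simp add: bubble_def powr_mult less_imp_le)
  have "(LINT \<zeta>|round_volume. ?f \<zeta>) = (LINT y|lborel. phi y ^ ?N * ?f (stereo_inv y))"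
    unfolding round_volume_eq sphere_measure_def
    using measurable_compose[OF stereo_inv_measurable f]
    by (subst integral_distr[OF _ f]) (simp_all add: integral_real_density less_imp_le)
  moreover have "bubble x * (phi y ^ ?N * ?f (stereo_inv y))
      = (bubble y * ?U x - iota u y) / norm (x - y) ^ ?N" for y
    using bubble_pos[of x] bubble_pos[of y]
    by (simp add: chordal_distance power_mult_distrib root half[symmetric] iota_eq
        right_diff_distrib[symmetric] less_imp_neq[symmetric] del: bubble_pos)
  ultimately have "bubble x * (LINT \<zeta>|round_volume. ?f \<zeta>)
      = (LINT y|lborel. (bubble y * ?U x - iota u y) / norm (x - y) ^ ?N)"
    by (simp del: times_divide_eq_right flip: integral_mult_right_zero)
  then show ?thesis
    by (simp add: Plog_def distrib_left iota_eq mult_ac)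
qed

theorem proposition1p3:
  fixes u :: "(real ^ 'n::finite) \<times> real \<Rightarrow> real" and v :: "real ^ 'n \<Rightarrow> real"
  assumes "smooth_on_sphere u"
    and "v = iota u"
  shows "\<forall>x. iota (Plog u) x = phi x powr (real CARD('n) / 2) * Plog u (stereo_inv x) \<and>
             phi x powr (real CARD('n) / 2) * Plog u (stereo_inv x) =
               log_Laplacian v x - 2 * v x * ln (phi x)"
proof (intro allI conjI)
  fix x :: "real ^ 'n"
  show "iota (Plog u) x = phi x powr (real CARD('n) / 2) * Plog u (stereo_inv x)"
    by (simp add: iota_def)
  let ?N = "CARD('n)" and ?U = "\<lambda>y. u (stereo_inv y)"
  let ?q = "\<lambda>f y. (f x - f y) / norm (x - y) ^ ?N" and ?t = "\<lambda>f y. f y / norm (x - y) ^ ?N"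
  have v: "v y = bubble y * ?U y" for y using assms(2) by (simp add: iota_eq)
  have U: "Ck_on 1 UNIV ?U" by (rule smooth_on_sphere_compose[OF assms(1) sphere_param_stereo_inv])
  have "Ck_on 1 UNIV v"
    using bounded_bilinear.Ck_on_prod[OF bounded_bilinear_mult Ck_on_1_bubble U]
    by (simp add: v[abs_def])
  then have v1: "set_integrable lborel (ball x 1) (?q v)" by (rule set_integrable_difference_quotient)
  note w1 = set_integrable_difference_quotient[OF Ck_on_1_bubble, of x]
  note w2 = set_integrable_bubble_tail[of x]
  \<comment> \<open>Here \<open>u\<close> enters through its boundedness: the tail of
    \<open>v\<close> is dominated by a multiple of the bubble tail.\<close>
  have v2: "set_integrable lborel (- ball x 1) (?t v)"
  proof -
    obtain C where C: "\<And>y. \<bar>?U y\<bar> \<le> C" using smooth_on_sphere_bounded[OF assms(1)] by blast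
    have "continuous_on UNIV ?U"
      using smooth_on_sphere_compose[OF assms(1) sphere_param_stereo_inv, of 0] by simp
    then have [measurable]: "?U \<in> borel_measurable borel" by (rule borel_measurable_continuous_onI)
    have [measurable]: "- ball x 1 \<in> sets borel" by simp
    have "set_integrable lborel (- ball x 1) (\<lambda>y. C * ?t bubble y)"
      using w2 by (rule set_integrable_mult_right)
    then show ?thesis
    proof (rule set_integrable_bound)
      show "set_borel_measurable lborel (- ball x 1) (?t v)"
        unfolding set_borel_measurable_def v by measurable
      show "AE y in lborel. y \<in> - ball x 1 \<longrightarrow> norm (?t v y) \<le> norm (C * ?t bubble y)"
      proof (intro AE_I2 impI)
        fix y
        have "\<bar>v y\<bar> = \<bar>?U y\<bar> * bubble y"
          by (simp add: v abs_mult abs_of_pos[OF bubble_pos])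
        also have "\<dots> \<le> C * bubble y"
          by (intro mult_right_mono C less_imp_le bubble_pos)
        also have "\<dots> \<le> \<bar>C * bubble y\<bar>" by (rule abs_ge_self)
        finally show "norm (?t v y) \<le> norm (C * ?t bubble y)"
          by (simp add: divide_right_mono)
      qed
    qed
  qed
  \<comment> \<open>On the ball, the zero \<open>v x - ?U x * bubble x\<close> is inserted to form
    two difference quotients; outside, the terms are integrable one by one.\<close>
  have "(LINT y|lborel. (bubble y * ?U x - v y) / norm (x - y) ^ ?N)
      = (LINT y:ball x 1|lborel. ?q v y - ?U x * ?q bubble y)
      + (LINT y:- ball x 1|lborel. ?U x * ?t bubble y - ?t v y)"
  proof (rule set_integral_split(2))
    show "set_integrable lborel (ball x 1) (\<lambda>y. ?q v y - ?U x * ?q bubble y)"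
      by (intro set_integral_diff set_integrable_mult_right v1 w1)
    show "set_integrable lborel (- ball x 1) (\<lambda>y. ?U x * ?t bubble y - ?t v y)"
      by (intro set_integral_diff set_integrable_mult_right v2 w2)
  qed (simp_all add: v diff_divide_distrib algebra_simps)
  also have "(LINT y:ball x 1|lborel. ?q v y - ?U x * ?q bubble y)
      = (LINT y:ball x 1|lborel. ?q v y) - (LINT y:ball x 1|lborel. ?U x * ?q bubble y)"
    by (intro set_integral_diff set_integrable_mult_right v1 w1)
  also have "(LINT y:ball x 1|lborel. ?U x * ?q bubble y) = ?U x * (LINT y:ball x 1|lborel. ?q bubble y)"
    by (rule set_integral_mult_right)
  also have "(LINT y:- ball x 1|lborel. ?U x * ?t bubble y - ?t v y)
      = (LINT y:- ball x 1|lborel. ?U x * ?t bubble y) - (LINT y:- ball x 1|lborel. ?t v y)"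
    by (intro set_integral_diff set_integrable_mult_right v2 w2)
  also have "(LINT y:- ball x 1|lborel. ?U x * ?t bubble y) = ?U x * (LINT y:- ball x 1|lborel. ?t bubble y)"
    by (rule set_integral_mult_right)
  finally have split: "(LINT y|lborel. (bubble y * ?U x - v y) / norm (x - y) ^ ?N)
      = (LINT y:ball x 1|lborel. ?q v y) - ?U x * (LINT y:ball x 1|lborel. ?q bubble y)
      + (?U x * (LINT y:- ball x 1|lborel. ?t bubble y) - (LINT y:- ball x 1|lborel. ?t v y))" .
  have "c_const ?N * (LINT y|lborel. (bubble y * ?U x - v y) / norm (x - y) ^ ?N)
      = (log_Laplacian v x - rho_const ?N * v x)
        - ?U x * (log_Laplacian bubble x - rho_const ?N * bubble x)"
    unfolding split log_Laplacian_def by (simp add: algebra_simps)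
  \<comment> \<open>The two \<open>rho_const\<close> terms cancel because
    \<open>v x = ?U x * bubble x\<close>. The \<open>A_const\<close> term that appears here cancels
    the one in \<open>Plog\<close>.\<close>
  also have "\<dots> = log_Laplacian v x - v x * (A_const ?N + 2 * ln (phi x))"
    by (simp add: log_Laplacian_bubble v algebra_simps)
  finally show "phi x powr (real ?N / 2) * Plog u (stereo_inv x)
      = log_Laplacian v x - 2 * v x * ln (phi x)"
    using Plog_stereo_inv[OF assms(1), of x] unfolding assms(2)[symmetric]
    by (simp add: bubble_def[symmetric] algebra_simps)
qed

end
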